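(* Let $1<p<\infty$, let $p'$ be its conjugate index ($\frac1p+\frac1{p'}=1$), and let $g\in\mathcal H(\mathbb D)$ be such that $$\sum_{k=0}^{\infty}(k+1)^{p'-2}\left(\sum_{n=0}^{\infty}\frac{(n+1)|\widehat g(n+1)|}{n+k+1}\right)^{p'}<\infty .$$ If $X_p\in\{H^p,\,D^p_{p-1},\,HL_p\}$, then $T_g:X_p\to H^\infty$ is bounded and $$\|T_g\|_{X_p\to H^\infty}^{p'}\le C\sum_{k=0}^{\infty}(k+1)^{p'-2}\left(\sum_{n=0}^{\infty}\frac{(n+1)|\widehat g(n+1)|}{n+k+1}\right)^{p'}$$ for a constant $C>0$ independent of $g$.
   Context: $\mathbb D=\{z\in\mathbb C:|z|<1\}$ and $\mathcal H(\mathbb D)$ is the space of analytic functions in $\mathbb D$. For $f\in\mathcal H(\mathbb D)$, $\widehat f(n)$ denotes the $n$-th Maclaurin coefficient. For $g\in\mathcal H(\mathbb D)$, $T_g(f)(z)=\int_0^z f(\zeta)g'(\zeta)\,d\zeta$, $z\in\mathbb D$. $H^p$ ($0<p\le\infty$) is the Hardy space with $\|f\|_{H^p}=\sup_{0<r<1}M_p(r,f)$, where $M_p(r,f)=\left(\frac1{2\pi}\int_0^{2\pi}|f(re^{i\theta})|^p\,d\theta\right)^{1/p}$ for $p<\infty$ and $M_\infty(r,f)=\max_\theta|f(re^{i\theta})|$. $D^p_{p-1}$ is the space of $f\in\mathcal H(\mathbb D)$ with $\|f\|_{D^p_{p-1}}^p=\int_{\mathbb D}|f'(z)|^p(1-|z|)^{p-1}\,dA(z)+|f(0)|^p<\infty$,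 where $dA=\frac{dx\,dy}{\pi}$. $HL_p$ is the space of $f\in\mathcal H(\mathbb D)$ with $\|f\|_{HL_p}^p=\sum_{n=0}^\infty|\widehat f(n)|^p(n+1)^{p-2}<\infty$. *)

theory Defs
  imports "HOL-Complex_Analysis.Complex_Analysis"
begin

text \<open>
  Norms take values in \<^typ>\<open>ennreal\<close>; a holomorphic function on the disc belongs to the space iff
  its norm is finite. Values of functions outside the open unit disc play no role.
  \<open>epowr x a\<close> is \<open>x\<^sup>a\<close> for \<open>x \<in> [0, \<infinity>]\<close> and is only meant for \<open>a > 0\<close>.
\<close>

definition epowr :: "ennreal \<Rightarrow> real \<Rightarrow> ennreal" where
  "epowr x a = (if x = \<infinity> then \<infinity> else ennreal (enn2real x powr a))"

definition maclaurin :: "(complex \<Rightarrow> complex) \<Rightarrow> nat \<Rightarrow> complex" where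
  "maclaurin f n = fps_nth (fps_expansion f 0) n"

definition T_op :: "(complex \<Rightarrow> complex) \<Rightarrow> (complex \<Rightarrow> complex) \<Rightarrow> complex \<Rightarrow> complex" where
  "T_op g f z = contour_integral (linepath 0 z) (\<lambda>\<zeta>. f \<zeta> * deriv g \<zeta>)"

definition hardy_mean :: "real \<Rightarrow> real \<Rightarrow> (complex \<Rightarrow> complex) \<Rightarrow> ennreal" where
  "hardy_mean p r f =
     epowr (ennreal (1 / (2 * pi)) *
            (\<integral>\<^sup>+\<theta>\<in>{0..2 * pi}. ennreal (cmod (f (of_real r * cis \<theta>)) powr p) \<partial>lborel))
       (1 / p)"

definition hardy_norm :: "real \<Rightarrow> (complex \<Rightarrow> complex) \<Rightarrow> ennreal" where
  "hardy_norm p f = (SUP r\<in>{0<..<1}. hardy_mean p r f)"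

definition hardy_mean_inf :: "real \<Rightarrow> (complex \<Rightarrow> complex) \<Rightarrow> ennreal" where
  "hardy_mean_inf r f = (SUP \<theta>\<in>{0..2 * pi}. ennreal (cmod (f (of_real r * cis \<theta>))))"

definition hardy_norm_inf :: "(complex \<Rightarrow> complex) \<Rightarrow> ennreal" where
  "hardy_norm_inf f = (SUP r\<in>{0<..<1}. hardy_mean_inf r f)"

text \<open>The normalised area measure is \<open>dA = dx dy / \<pi>\<close>.\<close>

definition dirichlet_norm :: "real \<Rightarrow> (complex \<Rightarrow> complex) \<Rightarrow> ennreal" where
  "dirichlet_norm p f =
     epowr (ennreal (1 / pi) *
            (\<integral>\<^sup>+z\<in>ball 0 1. ennreal (cmod (deriv f z) powr p * (1 - cmod z) powr (p - 1)) \<partial>lborel)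
            + ennreal (cmod (f 0) powr p))
       (1 / p)"

definition HL_norm :: "real \<Rightarrow> (complex \<Rightarrow> complex) \<Rightarrow> ennreal" where
  "HL_norm p f =
     epowr (\<Sum>n. ennreal (cmod (maclaurin f n) powr p * (real n + 1) powr (p - 2))) (1 / p)"

definition hol_space :: "((complex \<Rightarrow> complex) \<Rightarrow> ennreal) \<Rightarrow> (complex \<Rightarrow> complex) set" where
  "hol_space N = {f. f holomorphic_on ball 0 1 \<and> N f < \<infinity>}"

definition bounded_op ::
  "((complex \<Rightarrow> complex) \<Rightarrow> complex \<Rightarrow> complex) \<Rightarrow>
   ((complex \<Rightarrow> complex) \<Rightarrow> ennreal) \<Rightarrow> ((complex \<Rightarrow> complex) \<Rightarrow> ennreal) \<Rightarrow> bool" where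
  "bounded_op T N M \<longleftrightarrow>
     (\<forall>f\<in>hol_space N. T f \<in> hol_space M) \<and>
     (\<exists>K::real. \<forall>f\<in>hol_space N. M (T f) \<le> ennreal K * N f)"

definition op_norm ::
  "((complex \<Rightarrow> complex) \<Rightarrow> complex \<Rightarrow> complex) \<Rightarrow>
   ((complex \<Rightarrow> complex) \<Rightarrow> ennreal) \<Rightarrow> ((complex \<Rightarrow> complex) \<Rightarrow> ennreal) \<Rightarrow> ennreal" where
  "op_norm T N M = (SUP f\<in>{f \<in> hol_space N. N f \<le> 1}. M (T f))"

definition coeff_sum :: "real \<Rightarrow> (complex \<Rightarrow> complex) \<Rightarrow> ennreal" where
  "coeff_sum q g =
     (\<Sum>k. ennreal ((real k + 1) powr (q - 2)) *
        epowr (\<Sum>n. ennreal ((real n + 1) * cmod (maclaurin g (n + 1)) / (real n + real k + 1))) q)"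

end

theory Submission
  imports Defs
begin

text \<open>
  Let \<open>q = p'\<close>, \<open>b\<^sub>n = (n + 1) \<bar>g\<^sub>n\<^sub>+\<^sub>1\<bar>\<close>, \<open>G(t) = \<Sum> b\<^sub>n t\<^sup>n\<close> and
  \<open>S\<^sub>k = \<integral>\<^sub>0\<^sup>1 t\<^sup>k G(t) dt = \<Sum> b\<^sub>n / (n + k + 1)\<close>. Since \<open>\<bar>g'(tz)\<bar> \<le> G(t)\<close>, one has
  \<open>\<bar>T\<^sub>g f(z)\<bar> \<le> \<integral>\<^sub>0\<^sup>1 \<bar>f(tz)\<bar> G(t) dt\<close>, so only the values of \<open>f\<close> on one radius matter.
  There is a step function \<open>W\<close> on \<open>[0, 1)\<close> with \<open>\<integral> W\<^sup>q \<le> C \<Sum> (k + 1)\<^sup>q\<^sup>-\<^sup>2 S\<^sub>k\<^sup>q\<close>, \<open>G \<le> W\<close> and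
  \<open>\<integral>\<^sub>\<tau>\<^sup>1 G \<le> (1 - \<tau>) W(\<tau>)\<close>. In each case Hoelder's inequality finishes the proof:

  \<^item> for \<open>HL\<^sub>p\<close>, \<open>\<bar>f(tz)\<bar> \<le> \<Sum> \<bar>f\<^sub>k\<bar> t\<^sup>k\<close> turns the integral into \<open>\<Sum> \<bar>f\<^sub>k\<bar> S\<^sub>k\<close>;
  \<^item> for \<open>H\<^sup>p\<close>, Cauchy's formula and a Hilbert-type inequality bound the \<open>L\<^sup>p\<close> norm of \<open>f\<close> on a radius
    by \<open>\<parallel>f\<parallel>\<close> (Fejer and Riesz);
  \<^item> for \<open>D\<^sup>p\<^sub>p\<^sub>-\<^sub>1\<close>, Tonelli's theorem turns the integral into
    \<open>\<bar>f(0)\<bar> S\<^sub>0 + \<integral> \<bar>f'(\<tau>z)\<bar> (1 - \<tau>) W(\<tau>) d\<tau>\<close>, and the area mean value property gives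
    \<open>\<integral> \<bar>f'(\<tau>z)\<bar>\<^sup>p (1 - \<tau>)\<^sup>p d\<tau> \<le> C \<integral>\<^sub>D \<bar>f'\<bar>\<^sup>p (1 - \<bar>w\<bar>)\<^sup>p\<^sup>-\<^sup>1 dA\<close>.
\<close>

section \<open>Hoelder's inequality\<close>

lemma epowr_ennreal: "0 \<le> x \<Longrightarrow> epowr (ennreal x) a = ennreal (x powr a)"
  by (simp add: epowr_def)

text \<open>The norms are \<open>p\<close>-th roots of integrals or sums; this trades a bound on a
  norm for one on the expression under the root. An infinite \<open>x\<close> makes both sides
  false.\<close>

lemma epowr_inverse_le_iff:
  assumes "0 < p" "0 \<le> A"
  shows "epowr x (1 / p) \<le> ennreal A \<longleftrightarrow> x \<le> ennreal (A powr p)"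
proof (cases x)
  case (real r)
  have "r powr (1 / p) \<le> A \<longleftrightarrow> r \<le> A powr p"
  proof
    assume "r powr (1 / p) \<le> A"
    then have "(r powr (1 / p)) powr p \<le> A powr p"
      using assms by (intro powr_mono2) auto
    then show "r \<le> A powr p" using assms real by (simp add: powr_powr)
  next
    assume "r \<le> A powr p"
    then have "r powr (1 / p) \<le> (A powr p) powr (1 / p)"
      using assms real by (intro powr_mono2) auto
    then show "r powr (1 / p) \<le> A" using assms by (simp add: powr_powr)
  qed
  then show ?thesis using real assms by (simp add: epowr_ennreal)
next
  case top
  then show ?thesis by (simp add: epowr_def top_unique)
qed

lemma epowr_mono:
  assumes "x \<le> y" "0 \<le> a"
  shows "epowr x a \<le> epowr y a"
proof (cases "y = \<infinity>")
  case False
  then have "x \<noteq> \<infinity>" "y < top" using assms by (auto simp: top_unique less_top)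
  moreover have "enn2real x powr a \<le> enn2real y powr a"
    using assms \<open>y < top\<close> by (intro powr_mono2 enn2real_mono) auto
  ultimately show ?thesis using False by (simp add: epowr_def ennreal_leI)
qed (simp add: epowr_def)

lemma ennreal_le_plus: "r \<le> x + y \<Longrightarrow> 0 \<le> x \<Longrightarrow> 0 \<le> y \<Longrightarrow> ennreal r \<le> ennreal x + ennreal y"
  by (simp add: ennreal_plus[symmetric] ennreal_leI del: ennreal_plus)

lemma conjugate_exponent_gt_1:
  fixes p q :: real
  assumes "1 < p" "1 / p + 1 / q = 1"
  shows "1 < q"
  using assms by (smt (verit) divide_less_eq_1_pos less_divide_eq_1_pos zero_less_divide_iff)

text \<open>Young's inequality for \<open>u / A\<close> and \<open>v / B\<close>. With this
  normalisation each of the two terms integrates to at most \<open>1 / p\<close> or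
  \<open>1 / q\<close>, so that the total is \<open>A * B\<close>.\<close>

lemma young_scaled:
  fixes u v A B :: real
  assumes "1 < p" "1 / p + 1 / q = 1" "0 \<le> u" "0 \<le> v" "0 < A" "0 < B"
  shows "u * v \<le> A * B * ((u powr p / A powr p) / p + (v powr q / B powr q) / q)"
proof -
  have q: "1 < q" using assms(1,2) by (rule conjugate_exponent_gt_1)
  have "(u / A) * (v / B) \<le> (u / A) powr p / p + (v / B) powr q / q"
    using assms q by (intro Youngs_inequality) auto
  then have "A * B * ((u / A) * (v / B)) \<le> A * B * ((u / A) powr p / p + (v / B) powr q / q)"
    using assms by (intro mult_left_mono) auto
  then show ?thesis using assms by (simp add: powr_divide)
qed

text \<open>Integrates \<open>young_scaled\<close>. The bounds \<open>A\<close> and \<open>B\<close>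
  are positive reals rather than the norms themselves, so no degenerate product of zero and infinity
  arises; the final limit argument removes the strictness.\<close>

lemma nn_integral_Hoelder:
  fixes u v :: "'a \<Rightarrow> real"
  assumes p: "1 < p" "1 / p + 1 / q = 1"
    and [measurable]: "u \<in> borel_measurable M" "v \<in> borel_measurable M"
    and nonneg: "\<And>x. 0 \<le> u x" "\<And>x. 0 \<le> v x"
    and A: "0 < A" "(\<integral>\<^sup>+x. ennreal (u x powr p) \<partial>M) \<le> ennreal (A powr p)"
    and B: "0 < B" "(\<integral>\<^sup>+x. ennreal (v x powr q) \<partial>M) \<le> ennreal (B powr q)"
  shows "(\<integral>\<^sup>+x. ennreal (u x * v x) \<partial>M) \<le> ennreal (A * B)"
proof -
  have q: "1 < q" using p by (rule conjugate_exponent_gt_1)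
  define a b where "a = A * B / (p * A powr p)" and "b = A * B / (q * B powr q)"
  have ab: "0 \<le> a" "0 \<le> b" using p q A B by (auto simp: a_def b_def)
  have "(\<integral>\<^sup>+x. ennreal (u x * v x) \<partial>M) \<le>
      (\<integral>\<^sup>+x. ennreal a * ennreal (u x powr p) + ennreal b * ennreal (v x powr q) \<partial>M)"
  proof (rule nn_integral_mono)
    fix x
    have "u x * v x \<le> a * u x powr p + b * v x powr q"
      using young_scaled[OF p nonneg(1)[of x] nonneg(2)[of x] A(1) B(1)]
      by (simp add: a_def b_def field_simps)
    then show "ennreal (u x * v x) \<le> ennreal a * ennreal (u x powr p) + ennreal b * ennreal (v x powr q)"
      using ab by (simp add: ennreal_mult[symmetric] ennreal_plus[symmetric] del: ennreal_plus)
  qed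
  also have "\<dots> = ennreal a * (\<integral>\<^sup>+x. ennreal (u x powr p) \<partial>M) + ennreal b * (\<integral>\<^sup>+x. ennreal (v x powr q) \<partial>M)"
    by (simp add: nn_integral_add nn_integral_cmult)
  also have "\<dots> \<le> ennreal a * ennreal (A powr p) + ennreal b * ennreal (B powr q)"
    using A B by (intro add_mono mult_left_mono) auto
  also have "\<dots> = ennreal (a * A powr p + b * B powr q)"
    using ab by (simp add: ennreal_mult)
  also have "a * A powr p + b * B powr q = A * B * (1 / p + 1 / q)"
    using A B p q by (simp add: a_def b_def field_simps)
  finally show ?thesis using p by simp
qed

lemma suminf_Hoelder:
  fixes u v :: "nat \<Rightarrow> real"
  assumes "1 < p" "1 / p + 1 / q = 1" "\<And>x. 0 \<le> u x" "\<And>x. 0 \<le> v x"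
    and "0 < A" "(\<Sum>n. ennreal (u n powr p)) \<le> ennreal (A powr p)"
    and "0 < B" "(\<Sum>n. ennreal (v n powr q)) \<le> ennreal (B powr q)"
  shows "(\<Sum>n. ennreal (u n * v n)) \<le> ennreal (A * B)"
  unfolding nn_integral_count_space_nat[symmetric]
  by (rule nn_integral_Hoelder[OF assms(1,2)])
     (use assms(3-) in \<open>auto simp: nn_integral_count_space_nat\<close>)

section \<open>Integrals of a power against the kernel \<open>1 / (y + s)\<close>\<close>

text \<open>Split at \<open>s = y\<close>. Up to \<open>y\<close> the denominator is at least
  \<open>y\<close>, leaving a power integrable at 0 because \<open>a < 1\<close>; beyond
  \<open>y\<close> it is at least \<open>s\<close>, leaving a power integrable at infinity because
  \<open>0 < a\<close>.\<close>

lemma nn_integral_powr_kernel: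
  assumes "0 < a" "a < 1" "0 < y"
  shows "(\<integral>\<^sup>+s\<in>{0<..}. ennreal (s powr (-a) / (y + s)) \<partial>lborel)
    \<le> ennreal ((1 / (1 - a) + 1 / a) * y powr (-a))"
proof -
  have 1: "(\<integral>\<^sup>+s. ennreal (s powr (-a)) * indicator {0..y} s \<partial>lborel) = ennreal (y powr (1 - a) / (1 - a))"
    using nn_integral_has_integral_lebesgue'[OF _ has_integral_powr_from_0[of "-a" y]] assms by simp
  have 2: "(\<integral>\<^sup>+s. ennreal (s powr (-a-1)) * indicator {y..} s \<partial>lborel) = ennreal (y powr (- a) / a)"
    using nn_integral_has_integral_lebesgue'[OF _ has_integral_powr_to_inf[of "-a-1" y]] assms by simp
  have "(\<integral>\<^sup>+s\<in>{0<..}. ennreal (s powr (-a) / (y + s)) \<partial>lborel) \<le>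
    (\<integral>\<^sup>+s. ennreal (1 / y) * (ennreal (s powr (-a)) * indicator {0..y} s) +
        ennreal (s powr (-a-1)) * indicator {y..} s \<partial>lborel)"
  proof (rule nn_integral_mono)
    fix s :: real
    consider "s \<le> 0" | "0 < s" "s \<le> y" | "y < s" by linarith
    then show "ennreal (s powr (-a) / (y + s)) * indicator {0<..} s \<le>
       ennreal (1 / y) * (ennreal (s powr (-a)) * indicator {0..y} s) +
        ennreal (s powr (-a-1)) * indicator {y..} s"
    proof cases
      case 2
      then have "s powr (-a) / (y + s) \<le> (1 / y) * s powr (-a)"
        using assms by (simp add: frac_le)
      then have "ennreal (s powr (-a) / (y + s)) \<le> ennreal (1 / y) * ennreal (s powr (-a))"
        using assms 2 by (simp add: ennreal_mult[symmetric] ennreal_leI)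
      also have "\<dots> \<le> \<dots> + ennreal (s powr (-a-1)) * indicator {y..} s" by simp
      finally show ?thesis using 2 by simp
    next
      case 3
      then have "s powr (-a) / (y + s) \<le> s powr (-a) / s"
        using assms by (intro divide_left_mono) auto
      also have "\<dots> = s powr (-a-1)"
        using 3 assms by (simp add: powr_diff)
      finally show ?thesis using 3 assms by (simp add: ennreal_leI)
    qed auto
  qed
  also have "\<dots> = ennreal (1 / y) * ennreal (y powr (1 - a) / (1 - a)) + ennreal (y powr (- a) / a)"
    by (simp add: nn_integral_add nn_integral_cmult 1 2)
  also have "\<dots> = ennreal ((1 / y) * (y powr (1 - a) / (1 - a)) + y powr (- a) / a)"
    using assms by (simp add: ennreal_mult[symmetric] ennreal_plus[symmetric] del: ennreal_plus)
  also have "(1 / y) * (y powr (1 - a) / (1 - a)) + y powr (- a) / a = (1 / (1 - a) + 1 / a) * y powr (-a)"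
    using assms by (simp add: powr_diff powr_minus field_simps)
  finally show ?thesis .
qed

section \<open>A Hilbert-type inequality\<close>

text \<open>For points of \<open>[0, 1]\<close> this is the distance modulo 1: only the integer
  shifts -1, 0 and 1 can be nearest.\<close>

definition circ_dist :: "real \<Rightarrow> real \<Rightarrow> real" where
  "circ_dist \<alpha> x = min \<bar>x - \<alpha>\<bar> (min \<bar>x - \<alpha> - 1\<bar> \<bar>x - \<alpha> + 1\<bar>)"

lemma circ_dist_nonneg: "0 \<le> circ_dist \<alpha> x"
  by (simp add: circ_dist_def)

lemma borel_measurable_circ_dist [measurable]: "circ_dist \<alpha> \<in> borel_measurable borel"
  unfolding circ_dist_def[abs_def] by measurable

text \<open>The minimum is one of three shifted distances, so the kernel is at most the sum of three
  translates of an even kernel. Each translate costs two half-line integrals, hence the factor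
  6.\<close>

lemma nn_integral_circ_dist_kernel:
  assumes a: "0 < a" "a < 1" "0 < y"
  shows "(\<integral>\<^sup>+x. ennreal (circ_dist \<alpha> x powr (-a) / (y + circ_dist \<alpha> x)) \<partial>lborel)
    \<le> ennreal (6 * (1 / (1 - a) + 1 / a) * y powr (-a))"
proof -
  define k where "k = (\<lambda>s. ennreal (s powr (-a) / (y + s)))"
  define K where "K = (1 / (1 - a) + 1 / a) * y powr (-a)"
  have K: "0 \<le> K" using a by (simp add: K_def)
  have [measurable]: "k \<in> borel_measurable borel" unfolding k_def by measurable
  have half: "(\<integral>\<^sup>+s. k s * indicator {0<..} s \<partial>lborel) \<le> ennreal K"
    using nn_integral_powr_kernel[OF a] by (simp add: k_def K_def)
  have line: "(\<integral>\<^sup>+x. k \<bar>x - c\<bar> \<partial>lborel) \<le> ennreal (2 * K)" for c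
  proof -
    have "(\<integral>\<^sup>+x. k \<bar>x - c\<bar> \<partial>lborel) = (\<integral>\<^sup>+x. k \<bar>x\<bar> \<partial>lborel)"
      using nn_integral_real_affine[of "\<lambda>x. k \<bar>x - c\<bar>" 1 c] by simp
    also have "\<dots> \<le> (\<integral>\<^sup>+s. k s * indicator {0<..} s + k (- s) * indicator {0<..} (- s) \<partial>lborel)"
    proof (rule nn_integral_mono)
      fix s :: real
      have "k 0 = 0" by (simp add: k_def)
      then show "k \<bar>s\<bar> \<le> k s * indicator {0<..} s + k (- s) * indicator {0<..} (- s)"
        by (auto simp: indicator_def abs_if)
    qed
    also have "\<dots> = (\<integral>\<^sup>+s. k s * indicator {0<..} s \<partial>lborel)
        + (\<integral>\<^sup>+s. k (- s) * indicator {0<..} (- s) \<partial>lborel)"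
      by (subst nn_integral_add) auto
    also have "(\<integral>\<^sup>+s. k (- s) * indicator {0<..} (- s) \<partial>lborel) = (\<integral>\<^sup>+s. k s * indicator {0<..} s \<partial>lborel)"
      using nn_integral_real_affine[of "\<lambda>s. k s * indicator {0<..} s" "-1" 0] by simp
    also have "(\<integral>\<^sup>+s. k s * indicator {0<..} s \<partial>lborel) + (\<integral>\<^sup>+s. k s * indicator {0<..} s \<partial>lborel)
        \<le> ennreal K + ennreal K"
      using half by (intro add_mono)
    also have "\<dots> = ennreal (2 * K)" using K by (simp add: ennreal_plus[symmetric] del: ennreal_plus)
    finally show ?thesis .
  qed
  have "(\<integral>\<^sup>+x. k (circ_dist \<alpha> x) \<partial>lborel) \<le>
      (\<integral>\<^sup>+x. k \<bar>x - \<alpha>\<bar> + (k \<bar>x - (\<alpha> + 1)\<bar> + k \<bar>x - (\<alpha> - 1)\<bar>) \<partial>lborel)"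
  proof (rule nn_integral_mono)
    fix x
    have le: "X \<le> X + (Y + Z)" "Y \<le> X + (Y + Z)" "Z \<le> X + (Y + Z)" for X Y Z :: ennreal
      by (auto simp: add_increasing add_increasing2)
    consider "circ_dist \<alpha> x = \<bar>x - \<alpha>\<bar>" | "circ_dist \<alpha> x = \<bar>x - (\<alpha> + 1)\<bar>"
      | "circ_dist \<alpha> x = \<bar>x - (\<alpha> - 1)\<bar>"
      unfolding circ_dist_def min_def by (smt (verit))
    then show "k (circ_dist \<alpha> x) \<le> k \<bar>x - \<alpha>\<bar> + (k \<bar>x - (\<alpha> + 1)\<bar> + k \<bar>x - (\<alpha> - 1)\<bar>)"
      by cases (simp_all only: le)
  qed
  also have "\<dots> = (\<integral>\<^sup>+x. k \<bar>x - \<alpha>\<bar> \<partial>lborel) +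
      ((\<integral>\<^sup>+x. k \<bar>x - (\<alpha> + 1)\<bar> \<partial>lborel) + (\<integral>\<^sup>+x. k \<bar>x - (\<alpha> - 1)\<bar> \<partial>lborel))"
    by (simp add: nn_integral_add)
  also have "\<dots> \<le> ennreal (2 * K) + (ennreal (2 * K) + ennreal (2 * K))"
    by (intro add_mono line)
  also have "\<dots> = ennreal (6 * K)" using K by (simp add: ennreal_plus[symmetric] del: ennreal_plus)
  finally show ?thesis unfolding k_def K_def by (simp only: mult.assoc)
qed

lemma nn_integral_reflected_kernel:
  assumes "0 < a" "a < 1" "0 < d"
  shows "(\<integral>\<^sup>+t\<in>{..<1}. ennreal ((1 - t) powr (-a) / ((1 - t) + d)) \<partial>lborel)
    \<le> ennreal ((1 / (1 - a) + 1 / a) * d powr (-a))"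
proof -
  have "(\<integral>\<^sup>+t\<in>{..<1}. ennreal ((1 - t) powr (-a) / ((1 - t) + d)) \<partial>lborel) =
      (\<integral>\<^sup>+s\<in>{0<..}. ennreal (s powr (-a) / (d + s)) \<partial>lborel)"
    by (subst nn_integral_real_affine[where c="-1" and t=1])
       (auto intro!: nn_integral_cong simp: indicator_def add.commute)
  then show ?thesis using nn_integral_powr_kernel[OF assms] by simp
qed

text \<open>A Schur test: Young's inequality is applied after weighting by powers of \<open>d / y\<close>, so that
  each of the two resulting terms can be integrated in the variable that carries only the kernel.\<close>

lemma hilbert_type_inequality:
  fixes u w :: "real \<Rightarrow> real"
  assumes p: "1 < p" "1 / p + 1 / q = 1"
    and [measurable]: "u \<in> borel_measurable borel" "w \<in> borel_measurable borel"
    and nonneg: "\<And>x. 0 \<le> u x" "\<And>t. 0 \<le> w t"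
    and supp: "\<And>t. 1 \<le> t \<Longrightarrow> w t = 0"
    and A: "0 < A" "(\<integral>\<^sup>+x. ennreal (u x powr p) \<partial>lborel) \<le> ennreal (A powr p)"
    and B: "0 < B" "(\<integral>\<^sup>+t. ennreal (w t powr q) \<partial>lborel) \<le> ennreal (B powr q)"
  shows "(\<integral>\<^sup>+t. \<integral>\<^sup>+x. ennreal (u x * w t / ((1 - t) + circ_dist \<alpha> x)) \<partial>lborel \<partial>lborel)
    \<le> ennreal (6 * (p + q) * A * B)"
proof -
  have q: "1 < q" using p by (rule conjugate_exponent_gt_1)
  \<comment> \<open>The kernel integrals are used with exponents \<open>1 / p\<close> and
    \<open>1 / q\<close>; conjugacy gives their constant the same value \<open>p + q\<close> in both
    cases.\<close>
  have pq: "1 / (1 - 1 / p) + 1 / (1 / p) = p + q" "1 / (1 - 1 / q) + 1 / (1 / q) = p + q"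
  proof -
    have e: "1 - 1 / p = 1 / q" "1 - 1 / q = 1 / p" using p(2) by auto
    show "1 / (1 - 1 / p) + 1 / (1 / p) = p + q" unfolding e by simp
    show "1 / (1 - 1 / q) + 1 / (1 / q) = p + q" unfolding e by simp
  qed
  have pq0: "0 \<le> p + q" "0 \<le> 6 * (p + q)" using p(1) q by auto
  define d where "d = circ_dist \<alpha>"
  have [measurable]: "d \<in> borel_measurable borel" by (simp add: d_def)
  define a b where "a = A * B / (p * A powr p)" and "b = A * B / (q * B powr q)"
  have ab: "0 \<le> a" "0 \<le> b" using p q A B by (auto simp: a_def b_def)
  define P where "P = (\<lambda>t x. ennreal (u x powr p * d x powr (1 / q)) *
    (ennreal ((1 - t) powr (- (1 / q)) / ((1 - t) + d x)) * indicator {..<1} t))"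
  define Q where "Q = (\<lambda>t x. ennreal (w t powr q * (1 - t) powr (1 / p)) *
    ennreal (d x powr (- (1 / p)) / ((1 - t) + d x)))"
  have [measurable]: "(\<lambda>(t, x). P t x) \<in> borel_measurable (lborel \<Otimes>\<^sub>M lborel)"
    "(\<lambda>(t, x). Q t x) \<in> borel_measurable (lborel \<Otimes>\<^sub>M lborel)"
    by (simp_all add: P_def Q_def split_beta')
  have pt: "ennreal (u x * w t / ((1 - t) + d x)) \<le> ennreal a * P t x + ennreal b * Q t x"
    if "0 < d x" for t x
  proof (cases "t < 1")
    case True
    define y where "y = 1 - t"
    have y: "0 < y" using True by (simp add: y_def)
    \<comment> \<open>The product is split as \<open>(u x * m) * (w t / m)\<close>. The exponent is
      chosen so that \<open>m powr p\<close> is the power \<open>1 / q\<close> of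
      \<open>d x / y\<close> and \<open>(1 / m) powr q\<close> its power \<open>- (1 / p)\<close>;
      after the kernel is integrated, the remaining powers of \<open>d x\<close> or \<open>y\<close>
      cancel.\<close>
    define m where "m = (d x / y) powr (1 / (p * q))"
    have m: "0 < m" using that y by (simp add: m_def)
    have mp: "m powr p = d x powr (1 / q) * y powr (- (1 / q))"
      using that y p by (simp add: m_def powr_powr powr_divide powr_minus field_simps)
    have mq: "(1 / m) powr q = d x powr (- (1 / p)) * y powr (1 / p)"
      using that y q by (simp add: m_def powr_powr powr_divide powr_minus field_simps)
    have "u x * w t = (u x * m) * (w t * (1 / m))" using m by simp
    also have "\<dots> \<le> A * B * (((u x * m) powr p / A powr p) / p + ((w t * (1 / m)) powr q / B powr q) / q)"
      using nonneg m by (intro young_scaled[OF p]) (auto simp: A B)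
    also have "\<dots> = a * (u x powr p * m powr p) + b * (w t powr q * (1 / m) powr q)"
      using nonneg(1)[of x] nonneg(2)[of t] m
      by (subst (1 2) powr_mult) (simp_all add: a_def b_def distrib_left mult_ac)
    finally have "u x * w t / (y + d x) \<le> (a * (u x powr p * m powr p) + b * (w t powr q * (1 / m) powr q)) / (y + d x)"
      using that y by (intro divide_right_mono) auto
    also have "\<dots> = a * (u x powr p * d x powr (1 / q) * (y powr (- (1 / q)) / (y + d x)))
        + b * (w t powr q * y powr (1 / p) * (d x powr (- (1 / p)) / (y + d x)))"
      unfolding mp mq by (simp add: add_divide_distrib mult_ac)
    finally have "ennreal (u x * w t / (y + d x)) \<le>
        ennreal (a * (u x powr p * d x powr (1 / q) * (y powr (- (1 / q)) / (y + d x))))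
        + ennreal (b * (w t powr q * y powr (1 / p) * (d x powr (- (1 / p)) / (y + d x))))"
      by (rule ennreal_le_plus) (use that y ab in auto)
    then show ?thesis
      using that y ab True unfolding P_def Q_def y_def[symmetric]
      by (simp add: ennreal_mult[symmetric])
  next
    case False
    then show ?thesis using supp by simp
  qed
  \<comment> \<open>Where \<open>d x = 0\<close> the powers of \<open>d x\<close> in
    \<open>P\<close> and \<open>Q\<close> are 0 by convention and the pointwise bound can fail; this
    concerns three points only.\<close>
  have "AE x in lborel. x \<notin> {\<alpha>, \<alpha> + 1, \<alpha> - 1}"
    by (intro AE_not_in finite_imp_null_set_lborel) auto
  then have ae: "AE x in lborel. 0 < d x"
    by eventually_elim (auto simp: d_def circ_dist_def)
  have "(\<integral>\<^sup>+t. \<integral>\<^sup>+x. P t x \<partial>lborel \<partial>lborel) = (\<integral>\<^sup>+x. \<integral>\<^sup>+t. P t x \<partial>lborel \<partial>lborel)"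
    by (rule lborel_pair.Fubini'[symmetric]) simp
  also have "\<dots> \<le> (\<integral>\<^sup>+x. ennreal (p + q) * ennreal (u x powr p) \<partial>lborel)"
  proof (rule nn_integral_mono_AE, use ae in eventually_elim)
    case (elim x)
    have "(\<integral>\<^sup>+t. P t x \<partial>lborel) = ennreal (u x powr p * d x powr (1 / q)) *
      (\<integral>\<^sup>+t\<in>{..<1}. ennreal ((1 - t) powr (- (1 / q)) / ((1 - t) + d x)) \<partial>lborel)"
      unfolding P_def by (subst nn_integral_cmult) auto
    also have "\<dots> \<le> ennreal (u x powr p * d x powr (1 / q)) * ennreal ((p + q) * d x powr (- (1 / q)))"
      using nn_integral_reflected_kernel[of "1 / q" "d x", unfolded pq] q elim
      by (intro mult_left_mono) auto
    also have "\<dots> = ennreal (p + q) * ennreal (u x powr p)"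
      unfolding ennreal_mult'[OF pq0(1), symmetric] ennreal_mult'[OF pq0(2), symmetric]
      using elim pq0 by (subst ennreal_mult[symmetric]) (simp_all add: powr_minus)
    finally show ?case .
  qed
  also have "\<dots> \<le> ennreal (p + q) * ennreal (A powr p)"
    using A by (subst nn_integral_cmult) (auto intro: mult_left_mono)
  finally have P: "(\<integral>\<^sup>+t. \<integral>\<^sup>+x. P t x \<partial>lborel \<partial>lborel) \<le> ennreal (p + q) * ennreal (A powr p)" .
  have "(\<integral>\<^sup>+t. \<integral>\<^sup>+x. Q t x \<partial>lborel \<partial>lborel)
      \<le> (\<integral>\<^sup>+t. ennreal (6 * (p + q)) * ennreal (w t powr q) \<partial>lborel)"
  proof (rule nn_integral_mono)
    fix t
    show "(\<integral>\<^sup>+x. Q t x \<partial>lborel) \<le> ennreal (6 * (p + q)) * ennreal (w t powr q)"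
    proof (cases "t < 1")
      case True
      have "(\<integral>\<^sup>+x. Q t x \<partial>lborel) = ennreal (w t powr q * (1 - t) powr (1 / p)) *
        (\<integral>\<^sup>+x. ennreal (d x powr (- (1 / p)) / ((1 - t) + d x)) \<partial>lborel)"
        unfolding Q_def by (subst nn_integral_cmult) auto
      also have "\<dots> \<le> ennreal (w t powr q * (1 - t) powr (1 / p)) *
          ennreal (6 * (p + q) * (1 - t) powr (- (1 / p)))"
        using nn_integral_circ_dist_kernel[of "1 / p" "1 - t" \<alpha>, unfolded pq] p(1) True
        by (intro mult_left_mono) (auto simp: d_def)
      also have "\<dots> = ennreal (6 * (p + q)) * ennreal (w t powr q)"
        unfolding ennreal_mult'[OF pq0(1), symmetric] ennreal_mult'[OF pq0(2), symmetric]
        using True pq0 by (subst ennreal_mult[symmetric]) (simp_all add: powr_minus)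
      finally show ?thesis .
    next
      case False
      then show ?thesis using supp q by (simp add: Q_def)
    qed
  qed
  also have "\<dots> \<le> ennreal (6 * (p + q)) * ennreal (B powr q)"
    using B by (subst nn_integral_cmult) (auto intro: mult_left_mono)
  finally have Q: "(\<integral>\<^sup>+t. \<integral>\<^sup>+x. Q t x \<partial>lborel \<partial>lborel)
      \<le> ennreal (6 * (p + q)) * ennreal (B powr q)" .
  have "(\<integral>\<^sup>+t. \<integral>\<^sup>+x. ennreal (u x * w t / ((1 - t) + d x)) \<partial>lborel \<partial>lborel)
      \<le> (\<integral>\<^sup>+t. \<integral>\<^sup>+x. ennreal a * P t x + ennreal b * Q t x \<partial>lborel \<partial>lborel)"
    using ae pt by (intro nn_integral_mono nn_integral_mono_AE) auto
  also have "\<dots> = ennreal a * (\<integral>\<^sup>+t. \<integral>\<^sup>+x. P t x \<partial>lborel \<partial>lborel)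
      + ennreal b * (\<integral>\<^sup>+t. \<integral>\<^sup>+x. Q t x \<partial>lborel \<partial>lborel)"
    by (simp add: nn_integral_add nn_integral_cmult)
  also have "\<dots> \<le> ennreal a * (ennreal (p + q) * ennreal (A powr p)) +
      ennreal b * (ennreal (6 * (p + q)) * ennreal (B powr q))"
    by (intro add_mono mult_left_mono P Q) auto
  also have "ennreal a * (ennreal (p + q) * ennreal (A powr p)) +
      ennreal b * (ennreal (6 * (p + q)) * ennreal (B powr q))
      = ennreal (a * ((p + q) * A powr p) + b * (6 * (p + q) * B powr q))"
    using ab p q by (simp add: ennreal_mult[symmetric] ennreal_plus[symmetric] del: ennreal_plus)
  also have "\<dots> \<le> ennreal (6 * (p + q) * A * B)"
  proof (rule ennreal_leI)
    have e: "a * A powr p = A * B * (1 / p)" "b * B powr q = A * B * (1 / q)"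
      using A(1) B(1) p(1) q by (simp_all add: a_def b_def)
    have "a * ((p + q) * A powr p) + b * (6 * (p + q) * B powr q)
        = (p + q) * (a * A powr p) + 6 * (p + q) * (b * B powr q)"
      by (simp only: mult_ac)
    also have "\<dots> = A * B * (p + q) * (1 / p + 6 * (1 / q))"
      unfolding e by (simp only: distrib_left distrib_right mult_ac)
    \<comment> \<open>The two halves carry the factors 1 and 6; enlarging the first to 6 makes
      \<open>1 / p + 1 / q = 1\<close> applicable.\<close>
    also have "\<dots> \<le> A * B * (p + q) * (6 * (1 / p + 1 / q))"
      using A(1) B(1) p(1) q by (intro mult_left_mono) (auto simp: distrib_left intro!: divide_right_mono)
    finally show "a * ((p + q) * A powr p) + b * (6 * (p + q) * B powr q) \<le> 6 * (p + q) * A * B"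
      unfolding p(2) by (simp add: mult_ac)
  qed
  finally show ?thesis by (simp add: d_def)
qed

section \<open>Rotation invariance and mean values\<close>

lemma borel_measurable_Complex [measurable (raw)]:
  assumes [measurable]: "f \<in> borel_measurable M" "g \<in> borel_measurable M"
  shows "(\<lambda>x. Complex (f x) (g x)) \<in> borel_measurable M"
  unfolding Complex_eq by measurable

text \<open>Both measures give a box the product of its side lengths, and values on boxes determine
  \<open>lborel\<close>. This makes iterated integration in real and imaginary parts
  available.\<close>

lemma lborel_complex_eq:
  "(lborel :: complex measure) = distr (lborel \<Otimes>\<^sub>M lborel) borel (\<lambda>(x, y). Complex x y)"
proof (rule lborel_eqI)
  fix l u :: complex
  assume *: "\<And>b. b \<in> Basis \<Longrightarrow> l \<bullet> b \<le> u \<bullet> b"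
  have le: "Re l \<le> Re u" "Im l \<le> Im u"
    using *[of 1] *[of \<i>] by (auto simp: Basis_complex_def)
  have "emeasure (distr (lborel \<Otimes>\<^sub>M lborel) borel (\<lambda>(x, y). Complex x y)) (box l u)
      = emeasure (lborel \<Otimes>\<^sub>M lborel) ({Re l<..<Re u} \<times> {Im l<..<Im u})"
    by (subst emeasure_distr) (auto simp: in_box_complex_iff space_pair_measure intro!: arg_cong2[where f=emeasure])
  also have "\<dots> = ennreal ((Re u - Re l) * (Im u - Im l))"
    using le by (subst lborel.emeasure_pair_measure_Times) (auto simp: ennreal_mult)
  finally show "emeasure (distr (lborel \<Otimes>\<^sub>M lborel) borel (\<lambda>(x, y). Complex x y)) (box l u)
      = (\<Prod>b\<in>Basis. (u - l) \<bullet> b)"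
    by (simp add: Basis_complex_def)
qed simp

lemma nn_integral_lborel_complex:
  assumes [measurable]: "h \<in> borel_measurable borel"
  shows "(\<integral>\<^sup>+z. h z \<partial>lborel) = (\<integral>\<^sup>+x. \<integral>\<^sup>+y. h (Complex x y) \<partial>lborel \<partial>lborel)"
proof -
  show ?thesis
    unfolding lborel_complex_eq
    by (subst nn_integral_distr) (auto simp: lborel.nn_integral_fst[symmetric] split_beta')
qed

text \<open>For \<open>Re c \<noteq> 0\<close> the rotation is a composition of two substitutions in one real variable each.\<close>

lemma nn_integral_lborel_rotate_aux:
  assumes [measurable]: "h \<in> borel_measurable borel" and c: "cmod c = 1" "Re c \<noteq> 0"
  shows "(\<integral>\<^sup>+z. h (c * z) \<partial>lborel) = (\<integral>\<^sup>+z. h z \<partial>lborel)"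
proof -
  define a b where "a = Re c" and "b = Im c"
  have ab: "a * a + b * b = 1" and a: "a \<noteq> 0"
    using c by (auto simp: a_def b_def cmod_def power2_eq_square)
  have mult: "c * Complex x y = Complex (a * x - b * y) (b * x + a * y)" for x y
    by (simp add: a_def b_def complex_eq_iff)
  have "(\<integral>\<^sup>+z. h (c * z) \<partial>lborel)
      = (\<integral>\<^sup>+x. \<integral>\<^sup>+y. h (Complex (a * x - b * y) (b * x + a * y)) \<partial>lborel \<partial>lborel)"
    by (subst nn_integral_lborel_complex) (auto simp: mult)
  also have "\<dots> = (\<integral>\<^sup>+y. \<integral>\<^sup>+x. h (Complex (a * x - b * y) (b * x + a * y)) \<partial>lborel \<partial>lborel)"
    by (rule lborel_pair.Fubini') measurable
  \<comment> \<open>For fixed \<open>y\<close> the first coordinate becomes the new variable; by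
    \<open>a * a + b * b = 1\<close> the second one turns into \<open>b * x / a + y / a\<close>. The
    factor \<open>1 / a\<close> is used up by the later substitution in \<open>y\<close>.\<close>
  also have "\<dots> = (\<integral>\<^sup>+y. ennreal \<bar>1 / a\<bar> * (\<integral>\<^sup>+x. h (Complex x (b * x / a + (1 / a) * y)) \<partial>lborel) \<partial>lborel)"
  proof (rule nn_integral_cong)
    fix y
    have "(\<integral>\<^sup>+x. h (Complex (a * x - b * y) (b * x + a * y)) \<partial>lborel) =
      ennreal \<bar>1 / a\<bar> * (\<integral>\<^sup>+x. h (Complex (a * (b * y / a + (1 / a) * x) - b * y)
         (b * (b * y / a + (1 / a) * x) + a * y)) \<partial>lborel)"
      using a by (intro nn_integral_real_affine) auto
    moreover have "Complex (a * (b * y / a + (1 / a) * x) - b * y) (b * (b * y / a + (1 / a) * x) + a * y)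
        = Complex x (b * x / a + (1 / a) * y)" for x
    proof -
      have "b * (b * y / a + (1 / a) * x) + a * y = b * x / a + (a * a + b * b) * y / a"
        using a by (simp add: field_simps)
      then show ?thesis using a ab by (simp add: field_simps)
    qed
    ultimately show "(\<integral>\<^sup>+x. h (Complex (a * x - b * y) (b * x + a * y)) \<partial>lborel) =
      ennreal \<bar>1 / a\<bar> * (\<integral>\<^sup>+x. h (Complex x (b * x / a + (1 / a) * y)) \<partial>lborel)" by simp
  qed
  also have "\<dots> = ennreal \<bar>1 / a\<bar> * (\<integral>\<^sup>+y. \<integral>\<^sup>+x. h (Complex x (b * x / a + (1 / a) * y)) \<partial>lborel \<partial>lborel)"
    by (rule nn_integral_cmult) measurable
  also have "(\<integral>\<^sup>+y. \<integral>\<^sup>+x. h (Complex x (b * x / a + (1 / a) * y)) \<partial>lborel \<partial>lborel)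
      = (\<integral>\<^sup>+x. \<integral>\<^sup>+y. h (Complex x (b * x / a + (1 / a) * y)) \<partial>lborel \<partial>lborel)"
    by (rule lborel_pair.Fubini') measurable
  also have "ennreal \<bar>1 / a\<bar> * \<dots> =
      (\<integral>\<^sup>+x. ennreal \<bar>1 / a\<bar> * (\<integral>\<^sup>+y. h (Complex x (b * x / a + (1 / a) * y)) \<partial>lborel) \<partial>lborel)"
    by (rule nn_integral_cmult[symmetric]) measurable
  also have "\<dots> = (\<integral>\<^sup>+x. \<integral>\<^sup>+y. h (Complex x y) \<partial>lborel \<partial>lborel)"
    using a by (intro nn_integral_cong nn_integral_real_affine[symmetric]) auto
  finally show ?thesis by (simp add: nn_integral_lborel_complex)
qed

text \<open>If \<open>Re c = 0\<close>, then \<open>c\<close> is the product of \<open>c * e\<close>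
  and \<open>inverse e\<close>, where \<open>e\<close> is an eighth of a turn, and both factors have
  nonzero real part.\<close>

lemma nn_integral_lborel_rotate:
  assumes [measurable]: "h \<in> borel_measurable borel" and c: "cmod c = 1"
  shows "(\<integral>\<^sup>+z. h (c * z) \<partial>lborel) = (\<integral>\<^sup>+z. h z \<partial>lborel)"
proof (cases "Re c = 0")
  case False
  then show ?thesis using nn_integral_lborel_rotate_aux c by simp
next
  case True
  define e where "e = cis (pi / 4)"
  have e: "cmod e = 1" "Re e = sqrt 2 / 2" "Im e = sqrt 2 / 2"
    by (simp_all add: e_def cos_45 sin_45)
  have inv: "inverse e = cis (- (pi / 4))" by (simp add: e_def)
  have inv: "Re (inverse e) \<noteq> 0" "cmod (inverse e) = 1"
    unfolding inv by (simp_all add: cos_45)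
  have "Im c \<noteq> 0" using True c by (auto simp: cmod_def)
  then have "Re (c * e) \<noteq> 0" "Re (inverse e) \<noteq> 0" "cmod (c * e) = 1" "cmod (inverse e) = 1" "e \<noteq> 0"
    using True e c inv by (auto simp: norm_mult)
  moreover from this have "c * e * (inverse e * z) = c * z" for z by simp
  ultimately show ?thesis
    using nn_integral_lborel_rotate_aux[of "\<lambda>z. h (c * e * z)" "inverse e"]
      nn_integral_lborel_rotate_aux[of h "c * e"] by (simp only:) simp
qed

section \<open>Cauchy's formula and mean value bounds\<close>

lemma norm_integral_le_nn_integral:
  fixes h :: "real \<Rightarrow> 'a::euclidean_space"
  assumes "continuous_on {a..b} h"
  shows "ennreal (norm (integral {a..b} h)) \<le> (\<integral>\<^sup>+x\<in>{a..b}. ennreal (norm (h x)) \<partial>lborel)"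
proof -
  have i: "h integrable_on {a..b}" "(\<lambda>x. norm (h x)) integrable_on {a..b}"
    using assms by (auto intro!: integrable_continuous_interval continuous_on_norm)
  have "norm (integral {a..b} h) \<le> integral {a..b} (\<lambda>x. norm (h x))"
    using i by (intro integral_norm_bound_integral) auto
  moreover have "(\<integral>\<^sup>+x\<in>{a..b}. ennreal (norm (h x)) \<partial>lborel) = ennreal (integral {a..b} (\<lambda>x. norm (h x)))"
    using i by (intro nn_integral_has_integral_lebesgue') auto
  ultimately show ?thesis by (simp add: ennreal_leI)
qed

text \<open>Cauchy's formula with the circle parametrised over \<open>[0, 1]\<close>, where
  \<open>2 * pi * \<i>\<close> cancels against the velocity of the circle. At the centre,
  \<open>w = v\<close>, the kernel is 1 and this is the mean value bound; a general \<open>w\<close>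
  serves the Hardy case.\<close>

lemma cauchy_circle_bound:
  assumes F: "F holomorphic_on S" "cball v r \<subseteq> S" "open S" and w: "w \<in> ball v r"
  shows "ennreal (cmod (F w)) \<le> (\<integral>\<^sup>+x\<in>{0..1}. ennreal (cmod (F (v + of_real r * cis (2 * pi * x))) *
      (r / cmod (v + of_real r * cis (2 * pi * x) - w))) \<partial>lborel)"
proof -
  have r: "0 < r" using w by (smt (verit) mem_ball zero_le_dist)
  define \<gamma> where "\<gamma> = (\<lambda>x. v + of_real r * cis (2 * pi * x))"
  have \<gamma>: "circlepath v r x = \<gamma> x" for x
    by (simp add: circlepath_def \<gamma>_def part_circlepath_def linepath_def cis_conv_exp mult_ac)
  have exp_eq: "exp (2 * of_real pi * \<i> * of_real x) = cis (2 * pi * x)" for x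
    by (simp add: cis_conv_exp mult_ac)
  have "F holomorphic_on cball v r" using F holomorphic_on_subset by blast
  then have "((\<lambda>u. F u / (u - w)) has_contour_integral (2 * of_real pi * \<i> * F w)) (circlepath v r)"
    using w by (intro Cauchy_integral_circlepath_simple) (auto simp: dist_norm norm_minus_commute)
  then have "((\<lambda>x. F (\<gamma> x) / (\<gamma> x - w) * (2 * pi * \<i> * r * cis (2 * pi * x))) has_integral (2 * of_real pi * \<i> * F w)) {0..1}"
    unfolding has_contour_integral vector_derivative_circlepath \<gamma> exp_eq by simp
  then have *: "((\<lambda>x. (F (\<gamma> x) / (\<gamma> x - w) * (2 * pi * \<i> * r * cis (2 * pi * x))) / (2 * pi * \<i>)) has_integral (2 * of_real pi * \<i> * F w) / (2 * pi * \<i>)) {0..1}"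
    by (rule has_integral_divide)
  have I: "((\<lambda>x. F (\<gamma> x) / (\<gamma> x - w) * (r * cis (2 * pi * x))) has_integral F w) {0..1}"
  proof -
    have "X * (c * r * Y) / c = X * (r * Y)" "c * Z / c = Z" if "c \<noteq> 0" for c X Y Z :: complex
      using that by simp_all
    from this[of "2 * pi * \<i>"] * show ?thesis by simp
  qed
  have mem: "\<gamma> x \<in> S" for x using F(2) r by (auto simp: \<gamma>_def dist_norm norm_mult)
  have ne: "\<gamma> x \<noteq> w" for x using w r by (auto simp: \<gamma>_def dist_norm norm_mult)
  have "continuous_on {0..1} (\<lambda>x. F (\<gamma> x) / (\<gamma> x - w) * (r * cis (2 * pi * x)))"
  proof (intro continuous_intros)
    show "continuous_on {0..1} (\<lambda>x. F (\<gamma> x))"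
      by (rule continuous_on_compose2[OF holomorphic_on_imp_continuous_on[OF F(1)]])
         (use mem in \<open>auto simp: \<gamma>_def intro!: continuous_intros\<close>)
    show "continuous_on {0..1} \<gamma>" unfolding \<gamma>_def by (intro continuous_intros)
    show "\<forall>x\<in>{0..1}. \<gamma> x - w \<noteq> 0" using ne by auto
  qed
  from norm_integral_le_nn_integral[OF this] show ?thesis
    unfolding integral_unique[OF I]
    using r by (simp add: \<gamma>_def norm_mult norm_divide mult_ac)
qed

text \<open>Rotation invariance takes the place of polar coordinates. For each \<open>w\<close> in
  the disc the mean over the rotations of \<open>w\<close> dominates \<open>cmod (F v)\<close>;
  integrating over \<open>w\<close> and exchanging the integrals leaves the same area integral for
  every angle.\<close>

lemma area_mean_value_bound:
  assumes F: "F holomorphic_on ball v \<rho>" and \<rho>: "0 < \<rho>"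
  shows "ennreal (pi * \<rho>\<^sup>2) * ennreal (cmod (F v)) \<le> (\<integral>\<^sup>+w\<in>ball v \<rho>. ennreal (cmod (F w)) \<partial>lborel)"
proof -
  \<comment> \<open>Recentred at 0 and cut off outside the disc, since the hypothesis controls
    \<open>F\<close> only there.\<close>
  define h where "h = (\<lambda>w. ennreal (indicator (ball v \<rho>) (v + w) *\<^sub>R cmod (F (v + w))))"
  have [measurable]: "(\<lambda>w. indicator (ball v \<rho>) w *\<^sub>R cmod (F w)) \<in> borel_measurable borel"
    by (intro borel_measurable_continuous_on_indicator continuous_on_norm
        holomorphic_on_imp_continuous_on F) auto
  have [measurable]: "h \<in> borel_measurable borel" unfolding h_def by measurable
  have circ: "ennreal (cmod (F v)) * indicator (ball 0 \<rho>) w \<le>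
    (\<integral>\<^sup>+x\<in>{0..1}. h (cis (2 * pi * x) * w) \<partial>lborel)" for w
  proof (cases "w \<in> ball 0 \<rho> \<and> w \<noteq> 0")
    case True
    \<comment> \<open>Precomposition with the direction of \<open>w\<close> makes the circle about
      \<open>v\<close> start at \<open>v + w\<close>, so that its points are exactly
      \<open>v + cis (2 * pi * x) * w\<close>.\<close>
    define e where "e = cis (Arg w)"
    have w: "w = of_real (cmod w) * e" by (simp add: e_def rcis_cmod_Arg[unfolded rcis_def])
    have "(\<lambda>u. F (v + e * u)) holomorphic_on ball 0 \<rho>"
      by (rule holomorphic_on_compose_gen[OF _ F, unfolded o_def])
         (auto intro!: holomorphic_intros simp: e_def dist_norm norm_mult)
    moreover have "cball 0 (cmod w) \<subseteq> ball 0 \<rho>"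
      using True by auto
    ultimately
    have "ennreal (cmod (F v)) \<le> (\<integral>\<^sup>+x\<in>{0..1}. ennreal (cmod (F (v + e * (of_real (cmod w) * cis (2 * pi * x))))) \<partial>lborel)"
      using cauchy_circle_bound[of "\<lambda>u. F (v + e * u)" "ball 0 \<rho>" 0 "cmod w" 0] True
      by (simp add: norm_mult)
    also have "\<dots> = (\<integral>\<^sup>+x\<in>{0..1}. h (cis (2 * pi * x) * w) \<partial>lborel)"
    proof (intro nn_integral_cong)
      fix x
      have "cis (2 * pi * x) * w = e * (of_real (cmod w) * cis (2 * pi * x))"
        by (subst w) (simp add: mult_ac)
      then have eq: "e * (of_real (cmod w) * cis (2 * pi * x)) = cis (2 * pi * x) * w" by simp
      have "v + cis (2 * pi * x) * w \<in> ball v \<rho>"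
        using True by (simp add: dist_norm norm_mult)
      then show "ennreal (cmod (F (v + e * (of_real (cmod w) * cis (2 * pi * x))))) * indicator {0..1} x =
        h (cis (2 * pi * x) * w) * indicator {0..1} x"
        unfolding eq h_def by simp
    qed
    finally show ?thesis by (auto simp: indicator_def)
  next
    case False
    show ?thesis
    proof (cases "w = 0")
      \<comment> \<open>For \<open>w = 0\<close> the circle degenerates to its centre and the bound
        is an equality.\<close>
      case True
      have "(\<integral>\<^sup>+x\<in>{0..1::real}. h 0 \<partial>lborel) = h 0" by (simp add: nn_integral_cmult_indicator)
      then show ?thesis using True \<rho> by (simp add: h_def)
    qed (use False in auto)
  qed
  have "ennreal (pi * \<rho>\<^sup>2) * ennreal (cmod (F v)) = (\<integral>\<^sup>+w. ennreal (cmod (F v)) * indicator (ball 0 \<rho>) (w::complex) \<partial>lborel)"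
    using \<rho> by (subst nn_integral_cmult_indicator) (auto simp: emeasure_ball unit_ball_vol_2 mult.commute)
  also have "\<dots> \<le> (\<integral>\<^sup>+w. (\<integral>\<^sup>+x\<in>{0..1}. h (cis (2 * pi * x) * w) \<partial>lborel) \<partial>lborel)"
    by (intro nn_integral_mono circ)
  also have "\<dots> = (\<integral>\<^sup>+x. \<integral>\<^sup>+w. h (cis (2 * pi * x) * w) * indicator {0..1} x \<partial>lborel \<partial>lborel)"
    by (rule lborel_pair.Fubini') (auto simp: cis_conv_exp)
  also have "\<dots> = (\<integral>\<^sup>+x. (\<integral>\<^sup>+w. h w \<partial>lborel) * indicator {0..1::real} x \<partial>lborel)"
    by (intro nn_integral_cong) (simp add: nn_integral_multc nn_integral_lborel_rotate)
  also have "\<dots> = (\<integral>\<^sup>+w. h w \<partial>lborel)"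
    by (simp add: nn_integral_cmult_indicator)
  also have "\<dots> = (\<integral>\<^sup>+w. ennreal (indicator (ball v \<rho>) w *\<^sub>R cmod (F w)) \<partial>distr lborel borel ((+) v))"
    by (subst nn_integral_distr; (measurable; fail)?) (simp add: h_def)
  also have "\<dots> = (\<integral>\<^sup>+w\<in>ball v \<rho>. ennreal (cmod (F w)) \<partial>lborel)"
    unfolding lborel_distr_plus by (intro nn_integral_cong) (auto simp: indicator_def)
  finally show ?thesis .
qed

text \<open>With \<open>m = cmod (F v) / 2\<close>, the elementary bound
  \<open>cmod (F w) \<le> m + m powr (1 - p) * cmod (F w) powr p\<close> is inserted into the area
  mean value bound. The term from \<open>m\<close> is half of the left side and is absorbed, which
  is where \<open>2 powr p\<close> comes from.\<close>

lemma area_power_mean_bound: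
  assumes F: "F holomorphic_on ball v \<rho>" and \<rho>: "0 < \<rho>" and p: "1 \<le> p"
  shows "ennreal (cmod (F v) powr p) \<le>
    ennreal (2 powr p / (pi * \<rho>\<^sup>2)) * (\<integral>\<^sup>+w\<in>ball v \<rho>. ennreal (cmod (F w) powr p) \<partial>lborel)"
proof (cases "F v = 0")
  case False
  define m where "m = cmod (F v) / 2"
  have m: "0 < m" using False by (simp add: m_def)
  define V where "V = pi * \<rho>\<^sup>2"
  have V: "0 < V" using \<rho> by (simp add: V_def)
  have [measurable]: "(\<lambda>w. indicator (ball v \<rho>) w *\<^sub>R cmod (F w)) \<in> borel_measurable borel"
    by (intro borel_measurable_continuous_on_indicator continuous_on_norm
        holomorphic_on_imp_continuous_on F) auto
  have "(\<lambda>w. ennreal ((indicator (ball v \<rho>) w *\<^sub>R cmod (F w)) powr p)) \<in> borel_measurable borel"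
    by measurable
  also have "(\<lambda>w. ennreal ((indicator (ball v \<rho>) w *\<^sub>R cmod (F w)) powr p)) =
     (\<lambda>w. ennreal (cmod (F w) powr p) * indicator (ball v \<rho>) w)"
    using p by (auto simp: indicator_def)
  finally have [measurable]: "(\<lambda>w. ennreal (cmod (F w) powr p) * indicator (ball v \<rho>) w) \<in> borel_measurable borel" .
  have [measurable]: "(\<lambda>w. ennreal m * indicator (ball v \<rho>) w) \<in> borel_measurable borel"
    by (intro borel_measurable_times_ennreal borel_measurable_const borel_measurable_indicator) simp
  define I where "I = (\<integral>\<^sup>+w\<in>ball v \<rho>. ennreal (cmod (F w) powr p) \<partial>lborel)"
  have "ennreal V * ennreal (cmod (F v)) \<le> (\<integral>\<^sup>+w\<in>ball v \<rho>. ennreal (cmod (F w)) \<partial>lborel)"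
    unfolding V_def by (rule area_mean_value_bound[OF F \<rho>])
  also have "\<dots> \<le> (\<integral>\<^sup>+w. ennreal m * indicator (ball v \<rho>) w +
      ennreal (m powr (1 - p)) * (ennreal (cmod (F w) powr p) * indicator (ball v \<rho>) w) \<partial>lborel)"
  proof (rule nn_integral_mono)
    fix w
    have "cmod (F w) \<le> m + m powr (1 - p) * cmod (F w) powr p"
    proof (cases "cmod (F w) \<le> m")
      case False
      then have "1 \<le> (cmod (F w) / m) powr (p - 1)"
        using m p by (intro ge_one_powr_ge_zero) auto
      then have "cmod (F w) * 1 \<le> cmod (F w) * (cmod (F w) / m) powr (p - 1)"
        by (intro mult_left_mono) auto
      also have "\<dots> = m powr (1 - p) * cmod (F w) powr p"
        using m False by (simp add: powr_divide powr_diff field_simps)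
      finally show ?thesis using m by simp
    qed (use m in \<open>simp add: add_increasing2\<close>)
    then have "ennreal (cmod (F w)) \<le> ennreal m + ennreal (m powr (1 - p)) * ennreal (cmod (F w) powr p)"
      using m by (simp add: ennreal_mult[symmetric] ennreal_le_plus)
    then show "ennreal (cmod (F w)) * indicator (ball v \<rho>) w \<le> ennreal m * indicator (ball v \<rho>) w +
      ennreal (m powr (1 - p)) * (ennreal (cmod (F w) powr p) * indicator (ball v \<rho>) w)"
      by (auto simp: indicator_def)
  qed
  also have "\<dots> = ennreal m * ennreal V + ennreal (m powr (1 - p)) * I"
    using \<rho> by (subst nn_integral_add; (measurable; fail)?)
      (auto simp: nn_integral_cmult nn_integral_cmult_indicator emeasure_ball unit_ball_vol_2 V_def I_def)
  finally have le: "ennreal V * ennreal (cmod (F v)) \<le> ennreal m * ennreal V + ennreal (m powr (1 - p)) * I" .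
  show ?thesis unfolding I_def[symmetric] V_def[symmetric]
  proof (cases I)
    case (real r)
    from le have "V * (2 * m) \<le> m * V + m powr (1 - p) * r"
      using V m real by (simp add: m_def ennreal_mult[symmetric] ennreal_plus[symmetric] del: ennreal_plus)
    then have "m * V \<le> m powr (1 - p) * r" by (simp add: mult.commute)
    then have "m * V * m powr (p - 1) \<le> m powr (1 - p) * r * m powr (p - 1)"
      by (intro mult_right_mono) auto
    then have "m powr p * V \<le> r"
      using m by (simp add: powr_diff field_simps)
    then have "cmod (F v) powr p \<le> 2 powr p / V * r"
      using V by (simp add: m_def powr_divide field_simps)
    then show "ennreal (cmod (F v) powr p) \<le> ennreal (2 powr p / V) * I"
      using V real by (simp add: ennreal_mult[symmetric] ennreal_leI)
  next
    case top
    then show "ennreal (cmod (F v) powr p) \<le> ennreal (2 powr p / V) * I"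
      using V by (simp add: ennreal_mult_top)
  qed
qed (use p in simp)

section \<open>The majorant of the derivative of the symbol\<close>

lemma holomorphic_sums_maclaurin:
  assumes "f holomorphic_on ball 0 1" "cmod z < 1"
  shows "(\<lambda>n. maclaurin f n * z ^ n) sums f z"
  using holomorphic_power_series[OF assms(1), of z] assms(2)
  by (simp add: maclaurin_def fps_expansion_def)

lemma deriv_sums_maclaurin:
  assumes "g holomorphic_on ball 0 1" "cmod z < 1"
  shows "(\<lambda>n. of_nat (n + 1) * maclaurin g (n + 1) * z ^ n) sums deriv g z"
proof -
  have "maclaurin (deriv g) n = of_nat (n + 1) * maclaurin g (n + 1)" for n
  proof -
    have "(deriv ^^ n) (deriv g) 0 = (deriv ^^ (n + 1)) g 0"
      by (simp add: funpow_swap1)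
    moreover have "x / fact n = of_nat (Suc n) * (x / fact (Suc n))" for x :: complex
      by (simp add: fact_Suc del: of_nat_Suc)
    ultimately show ?thesis
      by (simp add: maclaurin_def fps_expansion_def del: funpow.simps fact_Suc of_nat_Suc)
  qed
  moreover have "deriv g holomorphic_on ball 0 1"
    using assms(1) by (intro holomorphic_deriv) auto
  ultimately show ?thesis using holomorphic_sums_maclaurin[of "deriv g" z] assms(2) by simp
qed

lemma norm_sums_le_suminf:
  fixes h :: "nat \<Rightarrow> 'a::real_normed_vector"
  assumes "h sums s"
  shows "ennreal (norm s) \<le> (\<Sum>n. ennreal (norm (h n)))"
proof (rule LIMSEQ_le_const2)
  show "(\<lambda>N. ennreal (norm (\<Sum>n<N. h n))) \<longlonglongrightarrow> ennreal (norm s)"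
    using assms by (intro tendsto_ennrealI tendsto_norm) (simp add: sums_def)
  have "ennreal (norm (\<Sum>n<N. h n)) \<le> (\<Sum>n. ennreal (norm (h n)))" for N
  proof -
    have "ennreal (norm (\<Sum>n<N. h n)) \<le> (\<Sum>n<N. ennreal (norm (h n)))"
      by (simp add: sum_ennreal ennreal_leI norm_sum)
    also have "\<dots> \<le> (\<Sum>n. ennreal (norm (h n)))"
      by (intro sum_le_suminf) auto
    finally show ?thesis .
  qed
  then show "\<exists>N. \<forall>n\<ge>N. ennreal (norm (\<Sum>n<n. h n)) \<le> (\<Sum>n. ennreal (norm (h n)))" by blast
qed

section \<open>Coefficients, majorant and moments\<close>

definition dcoeff :: "(complex \<Rightarrow> complex) \<Rightarrow> nat \<Rightarrow> real" where
  "dcoeff g n = (real n + 1) * cmod (maclaurin g (n + 1))"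

text \<open>The function \<open>G\<close> of the overview. Extended values let the series diverge,
  as it may at \<open>t = 1\<close>.\<close>

definition dmajorant :: "(complex \<Rightarrow> complex) \<Rightarrow> real \<Rightarrow> ennreal" where
  "dmajorant g t = (\<Sum>n. ennreal (dcoeff g n * t ^ n))"

text \<open>The moment \<open>S_k\<close> of the overview, given by its series;
  \<open>nn_integral_power_dmajorant\<close> identifies it with the integral.\<close>

definition dmoment :: "(complex \<Rightarrow> complex) \<Rightarrow> nat \<Rightarrow> ennreal" where
  "dmoment g k = (\<Sum>n. ennreal (dcoeff g n / (real n + real k + 1)))"

lemma dcoeff_nonneg: "0 \<le> dcoeff g n"
  by (simp add: dcoeff_def)

lemma borel_measurable_dmajorant [measurable]: "dmajorant g \<in> borel_measurable borel"
  unfolding dmajorant_def[abs_def] by measurable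

lemma dmajorant_mono: "0 \<le> s \<Longrightarrow> s \<le> t \<Longrightarrow> dmajorant g s \<le> dmajorant g t"
  unfolding dmajorant_def
  by (intro suminf_le ennreal_leI mult_left_mono power_mono dcoeff_nonneg) auto

lemma coeff_sum_eq: "coeff_sum q g = (\<Sum>k. ennreal ((real k + 1) powr (q - 2)) * epowr (dmoment g k) q)"
  by (simp add: coeff_sum_def dmoment_def dcoeff_def)

lemma cmod_deriv_le_dmajorant:
  assumes "g holomorphic_on ball 0 1" "cmod z \<le> t" "cmod z < 1"
  shows "ennreal (cmod (deriv g z)) \<le> dmajorant g t"
proof -
  have "ennreal (cmod (deriv g z)) \<le> (\<Sum>n. ennreal (norm (of_nat (n + 1) * maclaurin g (n + 1) * z ^ n)))"
    by (intro norm_sums_le_suminf deriv_sums_maclaurin assms)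
  also have "\<dots> = dmajorant g (cmod z)"
    unfolding dmajorant_def dcoeff_def norm_mult norm_power norm_of_nat by (simp add: add.commute)
  also have "\<dots> \<le> dmajorant g t" using assms by (intro dmajorant_mono) auto
  finally show ?thesis .
qed

lemma nn_integral_power_unit_interval:
  "(\<integral>\<^sup>+t\<in>{0..1}. ennreal (t ^ n) \<partial>lborel) = ennreal (1 / (real n + 1))"
proof -
  have "((\<lambda>t::real. t ^ n) has_integral (1 / (real n + 1) - 0)) {0..1}"
  proof -
    have "((\<lambda>t. t ^ Suc n / real (Suc n)) has_vector_derivative t ^ n) (at t within {0..1})" for t :: real
      unfolding has_real_derivative_iff_has_vector_derivative[symmetric]
      using DERIV_cdivide[OF DERIV_pow[of "Suc n" t], where c = "real (Suc n)"]
      by (simp del: of_nat_Suc power_Suc)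
    from fundamental_theorem_of_calculus[OF _ this] show ?thesis by (simp add: add.commute)
  qed
  then show ?thesis by (subst nn_integral_has_integral_lebesgue') auto
qed

lemma nn_integral_power_dmajorant:
  "(\<integral>\<^sup>+t\<in>{0..1}. ennreal (t ^ k) * dmajorant g t \<partial>lborel) = dmoment g k"
proof -
  have "(\<integral>\<^sup>+t\<in>{0..1}. ennreal (t ^ k) * dmajorant g t \<partial>lborel)
      = (\<integral>\<^sup>+t. (\<Sum>n. ennreal (dcoeff g n) * (ennreal (t ^ (n + k)) * indicator {0..1} t)) \<partial>lborel)"
  proof (rule nn_integral_cong)
    fix t :: real
    show "ennreal (t ^ k) * dmajorant g t * indicator {0..1} t =
      (\<Sum>n. ennreal (dcoeff g n) * (ennreal (t ^ (n + k)) * indicator {0..1} t))"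
    proof (cases "t \<in> {0..1}")
      case True
      have "ennreal (t ^ k) * dmajorant g t = (\<Sum>n. ennreal (t ^ k) * ennreal (dcoeff g n * t ^ n))"
        by (simp add: dmajorant_def)
      also have "\<dots> = (\<Sum>n. ennreal (dcoeff g n) * ennreal (t ^ (n + k)))"
        using True by (simp add: ennreal_mult[symmetric] dcoeff_nonneg power_add mult_ac)
      finally show ?thesis using True by simp
    qed simp
  qed
  also have "\<dots> = (\<Sum>n. ennreal (dcoeff g n) * (\<integral>\<^sup>+t\<in>{0..1}. ennreal (t ^ (n + k)) \<partial>lborel))"
    by (subst nn_integral_suminf) (auto simp: nn_integral_cmult)
  also have "\<dots> = dmoment g k"
    by (simp add: nn_integral_power_unit_interval dmoment_def ennreal_mult[symmetric] dcoeff_nonneg)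
  finally show ?thesis .
qed

lemma coeff_sum_term_le:
  "ennreal ((real k + 1) powr (q - 2)) * epowr (dmoment g k) q \<le> coeff_sum q g"
  unfolding coeff_sum_eq by (intro sum_le_suminf[of _ "{k}", simplified]) auto

text \<open>The weight of each term is positive, so a single infinite moment would make the whole
  sum infinite.\<close>

lemma dmoment_finite:
  assumes "coeff_sum q g < \<infinity>"
  shows "dmoment g k < \<infinity>"
proof (rule ccontr)
  assume "\<not> dmoment g k < \<infinity>"
  then have "dmoment g k = \<infinity>" by (simp add: less_top[symmetric])
  then show False
    using coeff_sum_term_le[of k q g] assms by (simp add: epowr_def ennreal_mult_top top_unique)
qed

text \<open>The term \<open>k = 0\<close> has weight 1. This handles the contribution of
  \<open>f 0\<close> in the Dirichlet case.\<close>

lemma dmoment_0_le: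
  assumes "coeff_sum q g \<le> ennreal (B powr q)" "0 < q" "0 < B"
  shows "dmoment g 0 \<le> ennreal B"
proof -
  have "epowr (dmoment g 0) (1 / (1 / q)) \<le> ennreal (B powr q)"
    using coeff_sum_term_le[of 0 q g] assms by simp
  then show ?thesis
    using epowr_inverse_le_iff[of "1 / q" "B powr q" "dmoment g 0"] assms by (simp add: powr_powr)
qed

section \<open>The dominating step function\<close>

text \<open>On \<open>[0, 1)\<close> this is the index \<open>k\<close> with
  \<open>1 - 1 / (k + 1) \<le> \<tau> < 1 - 1 / (k + 2)\<close>. The floor is at least 1 there, so
  the subtraction of naturals does not truncate.\<close>

definition tail_index :: "real \<Rightarrow> nat" where
  "tail_index \<tau> = nat \<lfloor>1 / (1 - \<tau>)\<rfloor> - 1"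

text \<open>A step function that dominates both \<open>dmajorant g \<tau>\<close> and its average over \<open>[\<tau>, 1]\<close>.\<close>

definition tail_weight :: "(complex \<Rightarrow> complex) \<Rightarrow> real \<Rightarrow> real" where
  "tail_weight g \<tau> = indicator {0..<1} \<tau> *
     (2 * exp 1 * (real (tail_index \<tau>) + 1) * enn2real (dmoment g (tail_index \<tau>)))"

lemma tail_index_bounds:
  assumes "0 \<le> \<tau>" "\<tau> < 1"
  shows "real (tail_index \<tau>) + 1 \<le> 1 / (1 - \<tau>)" "1 / (1 - \<tau>) < real (tail_index \<tau>) + 2"
proof -
  have "1 \<le> 1 / (1 - \<tau>)" using assms by (simp add: field_simps)
  then have "0 \<le> \<lfloor>1 / (1 - \<tau>)\<rfloor> - 1" by simp
  then obtain j where "\<lfloor>1 / (1 - \<tau>)\<rfloor> - 1 = int j" by (rule nonneg_int_cases)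
  then have "\<lfloor>1 / (1 - \<tau>)\<rfloor> = int (Suc j)" by simp
  then have "real (tail_index \<tau>) + 1 = of_int \<lfloor>1 / (1 - \<tau>)\<rfloor>"
    by (simp add: tail_index_def del: of_nat_Suc)
  then show "real (tail_index \<tau>) + 1 \<le> 1 / (1 - \<tau>)" "1 / (1 - \<tau>) < real (tail_index \<tau>) + 2"
    by linarith+
qed

lemma tail_weight_nonneg: "0 \<le> tail_weight g \<tau>"
  by (simp add: tail_weight_def)

lemma borel_measurable_tail_weight [measurable]: "tail_weight g \<in> borel_measurable borel"
proof -
  have [measurable]: "tail_index \<in> measurable borel (count_space UNIV)"
    unfolding tail_index_def[abs_def] by measurable
  show ?thesis unfolding tail_weight_def[abs_def] by measurable
qed

text \<open>\<open>(1 - 1 / (k + 1)) ^ k\<close> is the reciprocal of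
  \<open>(1 + 1 / k) ^ k\<close>, which is at most \<open>exp 1\<close>. Hence on a tail interval
  whose index is \<open>k\<close> the factor \<open>t ^ k\<close> costs only a constant.\<close>

lemma one_le_exp_power:
  assumes "1 - 1 / (real k + 1) \<le> t"
  shows "1 \<le> exp 1 * t ^ k"
proof (cases "k = 0")
  case False
  have "(1 + 1 / real k) ^ k \<le> exp (1 / real k) ^ k"
    by (intro power_mono exp_ge_add_one_self) auto
  also have "\<dots> = exp 1" using False by (simp add: exp_of_nat_mult[symmetric])
  finally have "1 \<le> exp 1 / (1 + 1 / real k) ^ k"
    using False by (simp add: le_divide_eq add_pos_pos)
  also have "\<dots> = exp 1 * (1 - 1 / (real k + 1)) ^ k"
  proof -
    have "1 - 1 / (real k + 1) = 1 / (1 + 1 / real k)" using False by (simp add: field_simps)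
    then show ?thesis by (simp add: power_divide)
  qed
  also have "\<dots> \<le> exp 1 * t ^ k"
    using assms by (intro mult_left_mono power_mono) auto
  finally show ?thesis .
qed simp

text \<open>Inserting the factor \<open>exp 1 * t ^ k\<close>, which is at least 1 on the tail,
  turns the tail integral into part of the moment of order \<open>k\<close>.\<close>

lemma tail_integral_le_tail_weight:
  assumes fin: "dmoment g (tail_index \<tau>) < \<infinity>" and \<tau>: "0 \<le> \<tau>" "\<tau> < 1"
  shows "(\<integral>\<^sup>+t\<in>{\<tau>..1}. dmajorant g t \<partial>lborel) \<le> ennreal ((1 - \<tau>) * tail_weight g \<tau>)"
proof -
  define k where "k = tail_index \<tau>"
  define s where "s = enn2real (dmoment g k)"
  have s: "dmoment g k = ennreal s" "0 \<le> s" using fin by (auto simp: s_def k_def)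
  have k: "real k + 1 \<le> 1 / (1 - \<tau>)" "1 / (1 - \<tau>) < real k + 2"
    unfolding k_def using tail_index_bounds[OF \<tau>] by auto
  have low: "1 - 1 / (real k + 1) \<le> \<tau>" using k(1) \<tau> by (simp add: field_simps)
  have "(\<integral>\<^sup>+t\<in>{\<tau>..1}. dmajorant g t \<partial>lborel) \<le>
      (\<integral>\<^sup>+t. ennreal (exp 1) * (ennreal (t ^ k) * dmajorant g t * indicator {0..1} t) \<partial>lborel)"
  proof (rule nn_integral_mono)
    fix t :: real
    show "dmajorant g t * indicator {\<tau>..1} t \<le>
      ennreal (exp 1) * (ennreal (t ^ k) * dmajorant g t * indicator {0..1} t)"
    proof (cases "t \<in> {\<tau>..1}")
      case True
      have "1 \<le> exp 1 * t ^ k" using low True by (intro one_le_exp_power) auto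
      then have "1 \<le> ennreal (exp 1) * ennreal (t ^ k)"
        using True \<tau> by (simp add: ennreal_mult[symmetric])
      then have "1 * dmajorant g t \<le> ennreal (exp 1) * ennreal (t ^ k) * dmajorant g t"
        by (intro mult_right_mono) auto
      then show ?thesis using True \<tau> by (simp add: mult.assoc)
    qed simp
  qed
  also have "\<dots> = ennreal (exp 1) * dmoment g k"
    by (simp add: nn_integral_cmult nn_integral_power_dmajorant)
  also have "\<dots> = ennreal (exp 1 * s)" using s by (simp add: ennreal_mult)
  also have "\<dots> \<le> ennreal ((1 - \<tau>) * tail_weight g \<tau>)"
  proof (rule ennreal_leI)
    \<comment> \<open>The factor 2 in \<open>tail_weight\<close> pays for passing from
      \<open>k + 2\<close> to \<open>k + 1\<close>.\<close>
    have "1 \<le> (1 - \<tau>) * (real k + 2)" using k(2) \<tau> by (simp add: field_simps)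
    also have "\<dots> \<le> (1 - \<tau>) * (2 * (real k + 1))" using \<tau> by (intro mult_left_mono) auto
    finally have "1 \<le> (1 - \<tau>) * (2 * (real k + 1))" .
    then have "exp 1 * s * 1 \<le> exp 1 * s * ((1 - \<tau>) * (2 * (real k + 1)))"
      using s by (intro mult_left_mono) auto
    then show "exp 1 * s \<le> (1 - \<tau>) * tail_weight g \<tau>"
      using \<tau> by (simp add: tail_weight_def k_def[symmetric] s_def mult_ac)
  qed
  finally show ?thesis .
qed

text \<open>The majorant is increasing, so its value at \<open>\<tau>\<close> is at most its average
  over \<open>[\<tau>, 1]\<close>.\<close>

lemma dmajorant_le_tail_weight:
  assumes fin: "dmoment g (tail_index \<tau>) < \<infinity>" and \<tau>: "0 \<le> \<tau>" "\<tau> < 1"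
  shows "dmajorant g \<tau> \<le> ennreal (tail_weight g \<tau>)"
proof -
  have "ennreal (1 - \<tau>) * dmajorant g \<tau> = (\<integral>\<^sup>+t. dmajorant g \<tau> * indicator {\<tau>..1} t \<partial>lborel)"
    using \<tau> by (subst nn_integral_cmult_indicator) (auto simp: mult.commute)
  also have "\<dots> \<le> (\<integral>\<^sup>+t\<in>{\<tau>..1}. dmajorant g t \<partial>lborel)"
    using \<tau> by (intro nn_integral_mono) (auto simp: indicator_def intro!: dmajorant_mono)
  also have "\<dots> \<le> ennreal ((1 - \<tau>) * tail_weight g \<tau>)"
    by (rule tail_integral_le_tail_weight[OF assms])
  also have "\<dots> = ennreal (1 - \<tau>) * ennreal (tail_weight g \<tau>)"
    using \<tau> by (simp add: ennreal_mult tail_weight_nonneg)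
  finally show ?thesis
    using \<tau> by (simp add: ennreal_mult_le_mult_iff)
qed

text \<open>The weight is constant on each interval of constant index \<open>k\<close>, whose length
  \<open>1 / ((k + 1) * (k + 2))\<close> is at most \<open>(k + 1) powr (- 2)\<close>. This turns
  the factor \<open>(k + 1) powr q\<close> into the weight of \<open>coeff_sum\<close>.\<close>

lemma nn_integral_tail_weight:
  assumes q: "0 < q" and fin: "coeff_sum q g < \<infinity>"
  shows "(\<integral>\<^sup>+\<tau>. ennreal (tail_weight g \<tau> powr q) \<partial>lborel) \<le> ennreal ((2 * exp 1) powr q) * coeff_sum q g"
proof -
  define s where "s = (\<lambda>k. enn2real (dmoment g k))"
  have s: "dmoment g k = ennreal (s k)" "0 \<le> s k" for k
    using dmoment_finite[OF fin, of k] by (auto simp: s_def)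
  define c where "c = (\<lambda>k. (2 * exp 1 * (real k + 1) * s k) powr q)"
  \<comment> \<open>Closed intervals that share endpoints are enough, since only an upper bound is
    sought.\<close>
  define J where "J = (\<lambda>k. {1 - 1 / (real k + 1)..1 - 1 / (real k + 2)})"
  have "(\<integral>\<^sup>+\<tau>. ennreal (tail_weight g \<tau> powr q) \<partial>lborel) \<le>
      (\<integral>\<^sup>+\<tau>. (\<Sum>k. ennreal (c k) * indicator (J k) \<tau>) \<partial>lborel)"
  proof (rule nn_integral_mono)
    fix \<tau> :: real
    show "ennreal (tail_weight g \<tau> powr q) \<le> (\<Sum>k. ennreal (c k) * indicator (J k) \<tau>)"
    proof (cases "\<tau> \<in> {0..<1}")
      case True
      define k where "k = tail_index \<tau>"
      have "\<tau> \<in> J k"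
        using tail_index_bounds[of \<tau>] True by (auto simp: J_def k_def[symmetric] field_simps)
      then have "ennreal (tail_weight g \<tau> powr q) = ennreal (c k) * indicator (J k) \<tau>"
        using True by (simp add: tail_weight_def c_def k_def[symmetric] s_def)
      also have "\<dots> \<le> (\<Sum>k. ennreal (c k) * indicator (J k) \<tau>)"
        by (intro sum_le_suminf[of _ "{k}", simplified]) auto
      finally show ?thesis .
    qed (use q in \<open>simp add: tail_weight_def\<close>)
  qed
  also have "\<dots> = (\<Sum>k. ennreal (c k) * emeasure lborel (J k))"
    by (subst nn_integral_suminf) (auto simp: nn_integral_cmult_indicator J_def)
  also have "\<dots> \<le> (\<Sum>k. ennreal ((2 * exp 1) powr q) *
      (ennreal ((real k + 1) powr (q - 2)) * epowr (dmoment g k) q))"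
  proof (rule suminf_le)
    fix k
    have "emeasure lborel (J k) = ennreal (1 / (real k + 1) - 1 / (real k + 2))"
      unfolding J_def by (subst emeasure_lborel_Icc) (auto simp: field_simps)
    also have "\<dots> \<le> ennreal ((real k + 1) powr (- 2))"
    proof (rule ennreal_leI)
      have "(real k + 1) powr (- 2) = 1 / (real k + 1) ^ 2"
        by (simp add: powr_minus_divide)
      moreover have "1 / (real k + 1) - 1 / (real k + 2) = 1 / ((real k + 1) * (real k + 2))"
        by (simp add: field_simps)
      moreover have "\<dots> \<le> 1 / (real k + 1) ^ 2"
        by (intro divide_left_mono) (auto simp: power2_eq_square)
      ultimately show "1 / (real k + 1) - 1 / (real k + 2) \<le> (real k + 1) powr (- 2)" by simp
    qed
    finally have "ennreal (c k) * emeasure lborel (J k) \<le> ennreal (c k) * ennreal ((real k + 1) powr (- 2))"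
      by (rule mult_left_mono) simp
    also have "\<dots> = ennreal (c k * (real k + 1) powr (- 2))"
      by (simp add: ennreal_mult c_def)
    also have "c k * (real k + 1) powr (- 2) = (2 * exp 1) powr q * ((real k + 1) powr (q - 2) * s k powr q)"
    proof -
      have 1: "c k = (2 * exp 1) powr q * (real k + 1) powr q * s k powr q"
        unfolding c_def using s(2)[of k] by (subst powr_mult[of _ "s k"], simp, simp, subst powr_mult, simp_all)
      have 2: "(real k + 1) powr (q - 2) = (real k + 1) powr q * (real k + 1) powr (- 2)"
        by (simp add: powr_add[symmetric])
      show ?thesis unfolding 1 2 by (simp only: mult_ac)
    qed
    also have "ennreal \<dots> = ennreal ((2 * exp 1) powr q) * (ennreal ((real k + 1) powr (q - 2)) * epowr (dmoment g k) q)"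
      using s[of k] by (simp add: epowr_ennreal ennreal_mult)
    finally show "ennreal (c k) * emeasure lborel (J k) \<le> ennreal ((2 * exp 1) powr q) *
      (ennreal ((real k + 1) powr (q - 2)) * epowr (dmoment g k) q)" .
  qed auto
  also have "\<dots> = ennreal ((2 * exp 1) powr q) * coeff_sum q g"
    by (simp add: coeff_sum_eq)
  finally show ?thesis .
qed

section \<open>The operator along a radius\<close>

text \<open>The segment from 0 to \<open>z\<close> has velocity \<open>z\<close>, of modulus below
  1, which is dropped; the point with parameter \<open>t\<close> has modulus at most
  \<open>t\<close>, so \<open>dmajorant g t\<close> bounds the derivative there.\<close>

lemma T_op_le_nn_integral:
  assumes f: "f holomorphic_on ball 0 1" and g: "g holomorphic_on ball 0 1" and z: "cmod z < 1"
  shows "ennreal (cmod (T_op g f z)) \<le>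
    (\<integral>\<^sup>+t\<in>{0..1}. ennreal (cmod (f (of_real t * z))) * dmajorant g t \<partial>lborel)"
proof -
  define h where "h = (\<lambda>t. f (of_real t * z) * deriv g (of_real t * z) * z)"
  have mem: "cmod (of_real t * z) < 1" if "t \<in> {0..1}" for t
    using that z mult_right_mono[of t 1 "cmod z"] by (auto simp: norm_mult)
  have dg: "deriv g holomorphic_on ball 0 1" using g by (intro holomorphic_deriv) auto
  have cont: "continuous_on {0..1} h"
    unfolding h_def
    by (intro continuous_intros continuous_on_compose2[OF holomorphic_on_imp_continuous_on[OF f]]
        continuous_on_compose2[OF holomorphic_on_imp_continuous_on[OF dg]])
       (use mem in auto)
  then have "(h has_integral integral {0..1} h) {0..1}"
    by (intro integrable_integral integrable_continuous_interval)
  then have "((\<lambda>\<zeta>. f \<zeta> * deriv g \<zeta>) has_contour_integral integral {0..1} h) (linepath 0 z)"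
    unfolding has_contour_integral_linepath by (simp add: h_def linepath_def scaleR_conv_of_real)
  then have "T_op g f z = integral {0..1} h"
    unfolding T_op_def by (rule contour_integral_unique)
  then have "ennreal (cmod (T_op g f z)) \<le> (\<integral>\<^sup>+t\<in>{0..1}. ennreal (cmod (h t)) \<partial>lborel)"
    using norm_integral_le_nn_integral[OF cont] by simp
  also have "\<dots> \<le> (\<integral>\<^sup>+t\<in>{0..1}. ennreal (cmod (f (of_real t * z))) * dmajorant g t \<partial>lborel)"
  proof (rule nn_integral_mono)
    fix t :: real
    show "ennreal (cmod (h t)) * indicator {0..1} t \<le>
      ennreal (cmod (f (of_real t * z))) * dmajorant g t * indicator {0..1} t"
    proof (cases "t \<in> {0..1}")
      case True
      have "cmod (h t) \<le> cmod (f (of_real t * z)) * cmod (deriv g (of_real t * z)) * 1"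
        unfolding h_def norm_mult using z by (intro mult_left_mono) auto
      then have "ennreal (cmod (h t)) \<le> ennreal (cmod (f (of_real t * z))) * ennreal (cmod (deriv g (of_real t * z)))"
        by (simp add: ennreal_mult[symmetric] ennreal_leI)
      also have "\<dots> \<le> ennreal (cmod (f (of_real t * z))) * dmajorant g t"
        using True z mem[OF True]
        by (intro mult_left_mono cmod_deriv_le_dmajorant[OF g]) (auto simp: norm_mult mult_left_le)
      finally show ?thesis using True by simp
    qed simp
  qed
  finally show ?thesis .
qed

text \<open>The disc is convex, so the integrand has a primitive \<open>F\<close>, and the segment
  integral is \<open>F z - F 0\<close>.\<close>

lemma T_op_holomorphic:
  assumes f: "f holomorphic_on ball 0 1" and g: "g holomorphic_on ball 0 1"
  shows "T_op g f holomorphic_on ball 0 1"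
proof -
  have hol: "(\<lambda>\<zeta>. f \<zeta> * deriv g \<zeta>) holomorphic_on ball 0 1"
    using f g by (intro holomorphic_intros holomorphic_deriv) auto
  obtain F where F: "\<And>x. x \<in> ball 0 1 \<Longrightarrow> (F has_field_derivative f x * deriv g x) (at x within ball 0 1)"
    using holomorphic_convex_primitive'[OF convex_ball open_ball hol] by blast
  have "T_op g f z = F z - F 0" if "z \<in> ball 0 1" for z
  proof -
    have "path_image (linepath 0 z) \<subseteq> ball 0 1"
      using that by (simp add: closed_segment_subset)
    then have "((\<lambda>\<zeta>. f \<zeta> * deriv g \<zeta>) has_contour_integral F z - F 0) (linepath 0 z)"
      using contour_integral_primitive[OF F, of "linepath 0 z"] by simp
    then show ?thesis unfolding T_op_def by (rule contour_integral_unique)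
  qed
  moreover have "F holomorphic_on ball 0 1"
    unfolding holomorphic_on_def field_differentiable_def using F by blast
  then have "(\<lambda>z. F z - F 0) holomorphic_on ball 0 1" by (intro holomorphic_intros)
  ultimately show ?thesis by (subst holomorphic_cong[OF refl]) auto
qed

section \<open>Bounds in the three spaces\<close>

lemma nn_integral_tail_weight_le:
  assumes "0 < q" "0 < B" "coeff_sum q g \<le> ennreal (B powr q)"
  shows "(\<integral>\<^sup>+\<tau>. ennreal (tail_weight g \<tau> powr q) \<partial>lborel) \<le> ennreal ((2 * exp 1 * B) powr q)"
proof -
  have fin: "coeff_sum q g < \<infinity>" using assms(3) by (rule le_less_trans) simp
  have "(\<integral>\<^sup>+\<tau>. ennreal (tail_weight g \<tau> powr q) \<partial>lborel) \<le> ennreal ((2 * exp 1) powr q) * coeff_sum q g"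
    by (rule nn_integral_tail_weight[OF assms(1) fin])
  also have "\<dots> \<le> ennreal ((2 * exp 1) powr q) * ennreal (B powr q)"
    using assms(3) by (rule mult_left_mono) simp
  also have "\<dots> = ennreal ((2 * exp 1 * B) powr q)"
    using assms(2) by (subst powr_mult) (simp_all add: ennreal_mult)
  finally show ?thesis .
qed

section \<open>The bound for \<open>HL_p\<close>\<close>

lemma T_op_bound_HL:
  assumes p: "1 < p" "1 / p + 1 / q = 1"
    and f: "f holomorphic_on ball 0 1" and g: "g holomorphic_on ball 0 1"
    and A: "0 < A" "HL_norm p f \<le> ennreal A"
    and B: "0 < B" "coeff_sum q g \<le> ennreal (B powr q)" and z: "cmod z < 1"
  shows "ennreal (cmod (T_op g f z)) \<le> ennreal (A * B)"
proof -
  have q: "1 < q" using p by (rule conjugate_exponent_gt_1)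
  have fin: "coeff_sum q g < \<infinity>" using B(2) by (rule le_less_trans) simp
  define a where "a = (\<lambda>k. cmod (maclaurin f k))"
  define s where "s = (\<lambda>k. enn2real (dmoment g k))"
  have s: "dmoment g k = ennreal (s k)" "0 \<le> s k" for k
    using dmoment_finite[OF fin, of k] by (auto simp: s_def)
  \<comment> \<open>The exponent that distributes the weights in Hoelder's inequality:
    \<open>(k + 1) powr e\<close> raised to \<open>p\<close> is the weight of
    \<open>HL_norm\<close>, and its reciprocal raised to \<open>q\<close> is the weight of
    \<open>coeff_sum\<close>, because \<open>q / p = q - 1\<close>.\<close>
  define e where "e = (p - 2) / p"
  have ep: "e * p = p - 2" using p by (simp add: e_def)
  have eq: "- e * q = q - 2"
  proof -
    have "1 / p = 1 - 1 / q" using p(2) by simp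
    then have "q / p = q - 1" using q by (simp add: field_simps)
    moreover have "e * q = q - 2 * (q / p)" using p(1) by (simp add: e_def field_simps)
    ultimately show ?thesis by simp
  qed
  have "ennreal (cmod (T_op g f z)) \<le> (\<integral>\<^sup>+t\<in>{0..1}. ennreal (cmod (f (of_real t * z))) * dmajorant g t \<partial>lborel)"
    by (rule T_op_le_nn_integral[OF f g z])
  also have "\<dots> \<le> (\<integral>\<^sup>+t. (\<Sum>k. ennreal (a k) * (ennreal (t ^ k) * dmajorant g t * indicator {0..1} t)) \<partial>lborel)"
  proof (rule nn_integral_mono)
    fix t :: real
    show "ennreal (cmod (f (of_real t * z))) * dmajorant g t * indicator {0..1} t \<le>
       (\<Sum>k. ennreal (a k) * (ennreal (t ^ k) * dmajorant g t * indicator {0..1} t))"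
    proof (cases "t \<in> {0..1}")
      case True
      have tz: "cmod (of_real t * z) \<le> t" "cmod (of_real t * z) < 1"
        using True z mult_right_mono[of t 1 "cmod z"] by (auto simp: norm_mult mult_left_le)
      have "ennreal (cmod (f (of_real t * z))) \<le> (\<Sum>k. ennreal (norm (maclaurin f k * (of_real t * z) ^ k)))"
        by (intro norm_sums_le_suminf holomorphic_sums_maclaurin f tz)
      also have "\<dots> \<le> (\<Sum>k. ennreal (a k) * ennreal (t ^ k))"
      proof (intro suminf_le)
        fix k
        have "norm (maclaurin f k * (of_real t * z) ^ k) \<le> a k * t ^ k"
          unfolding norm_mult norm_power a_def using tz(1) True
          by (intro mult_left_mono) (auto simp: norm_mult power_mult_distrib[symmetric] intro!: power_mono)
        then show "ennreal (norm (maclaurin f k * (of_real t * z) ^ k)) \<le> ennreal (a k) * ennreal (t ^ k)"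
          using True by (simp add: ennreal_mult[symmetric] a_def ennreal_leI)
      qed auto
      finally have "ennreal (cmod (f (of_real t * z))) * dmajorant g t \<le>
        (\<Sum>k. ennreal (a k) * ennreal (t ^ k)) * dmajorant g t" by (rule mult_right_mono) simp
      also have "\<dots> = (\<Sum>k. ennreal (a k) * (ennreal (t ^ k) * dmajorant g t))"
        by (simp add: mult.assoc flip: ennreal_suminf_multc)
      finally show ?thesis using True by simp
    qed simp
  qed
  also have "\<dots> = (\<Sum>k. ennreal (a k) * dmoment g k)"
    by (subst nn_integral_suminf) (auto simp: nn_integral_cmult nn_integral_power_dmajorant)
  also have "\<dots> = (\<Sum>k. ennreal ((a k * (real k + 1) powr e) * ((real k + 1) powr (- e) * s k)))"
  proof (rule suminf_cong)
    fix k
    have "(a k * (real k + 1) powr e) * ((real k + 1) powr (- e) * s k) = a k * s k"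
      by (simp add: powr_minus field_simps)
    then show "ennreal (a k) * dmoment g k = ennreal ((a k * (real k + 1) powr e) * ((real k + 1) powr (- e) * s k))"
      using s[of k] by (simp add: ennreal_mult[symmetric] a_def)
  qed
  also have "\<dots> \<le> ennreal (A * B)"
  proof (rule suminf_Hoelder[OF p])
    have "(\<Sum>n. ennreal (cmod (maclaurin f n) powr p * (real n + 1) powr (p - 2))) \<le> ennreal (A powr p)"
      using A p(1) unfolding HL_norm_def by (subst (asm) epowr_inverse_le_iff) auto
    moreover have "(a n * (real n + 1) powr e) powr p = cmod (maclaurin f n) powr p * (real n + 1) powr (p - 2)" for n
      by (simp add: a_def powr_mult powr_powr ep)
    ultimately show "(\<Sum>n. ennreal ((a n * (real n + 1) powr e) powr p)) \<le> ennreal (A powr p)" by simp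
    have "((real n + 1) powr (- e) * s n) powr q = (real n + 1) powr (q - 2) * s n powr q" for n
      using s(2)[of n] by (simp add: powr_mult powr_powr eq[simplified])
    moreover have "ennreal ((real n + 1) powr (q - 2) * s n powr q) = ennreal ((real n + 1) powr (q - 2)) * epowr (dmoment g n) q" for n
      using s[of n] by (simp add: epowr_ennreal ennreal_mult)
    ultimately show "(\<Sum>n. ennreal (((real n + 1) powr (- e) * s n) powr q)) \<le> ennreal (B powr q)"
      using B(2) by (simp add: coeff_sum_eq)
  qed (use A B s in \<open>auto simp: a_def\<close>)
  finally show ?thesis .
qed

section \<open>Radial integrals bounded by area integrals\<close>

text \<open>If \<open>w\<close> lies in the discs about two points of the radius, these points are
  within \<open>2 * (1 - cmod w)\<close> of each other. For \<open>cmod z \<ge> 1 / 2\<close> their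
  parameters are therefore within \<open>4 * (1 - cmod w)\<close>; for smaller \<open>cmod z\<close>
  one has \<open>1 - cmod w \<ge> 1 / 4\<close>, and the length 1 of the whole parameter interval
  suffices.\<close>

lemma nn_integral_shadow_le:
  assumes z: "cmod z < 1" and w: "cmod w < 1"
  shows "(\<integral>\<^sup>+\<tau>. (if \<tau> \<in> {0..1} \<and> dist (of_real \<tau> * z) w < (1 - \<tau> * cmod z) / 2 then 1 else 0) \<partial>lborel)
    \<le> ennreal (8 * (1 - cmod w))"
proof -
  define S where "S = {\<tau>\<in>{0..1}. dist (of_real \<tau> * z) w < (1 - \<tau> * cmod z) / 2}"
  have near: "dist (of_real \<tau> * z) w < 1 - cmod w \<and> (1 - \<tau> * cmod z) / 2 < 1 - cmod w
      \<and> 1 - cmod w < 3 / 2 * (1 - \<tau> * cmod z)" if "\<tau> \<in> S" for \<tau>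
  proof -
    have "dist (of_real \<tau> * z) w < (1 - \<tau> * cmod z) / 2" "cmod (of_real \<tau> * z) = \<tau> * cmod z"
      using that by (auto simp: S_def norm_mult)
    moreover have "\<bar>cmod (of_real \<tau> * z) - cmod w\<bar> \<le> dist (of_real \<tau> * z) w"
      unfolding dist_norm by (rule norm_triangle_ineq3)
    ultimately show ?thesis by (auto simp: field_simps)
  qed
  have [measurable]: "S \<in> sets borel" unfolding S_def by measurable
  have "(\<integral>\<^sup>+\<tau>. (if \<tau> \<in> {0..1} \<and> dist (of_real \<tau> * z) w < (1 - \<tau> * cmod z) / 2 then 1 else 0) \<partial>lborel)
      = (\<integral>\<^sup>+\<tau>. indicator S \<tau> \<partial>lborel)"
    by (intro nn_integral_cong) (auto simp: S_def indicator_def)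
  also have "\<dots> = emeasure lborel S" by simp
  also have "\<dots> \<le> ennreal (8 * (1 - cmod w))"
  proof (cases "S = {}")
    case False
    then obtain \<sigma> where \<sigma>: "\<sigma> \<in> S" by auto
    show ?thesis
    proof (cases "cmod z < 1 / 2")
      case True
      have "\<sigma> * cmod z \<le> 1 * cmod z" using \<sigma> by (intro mult_right_mono) (auto simp: S_def)
      then have "1 / 4 \<le> 1 - cmod w" using near[OF \<sigma>] True by simp
      have "emeasure lborel S \<le> emeasure lborel {0..1::real}"
        by (intro emeasure_mono) (auto simp: S_def)
      also have "\<dots> \<le> ennreal (8 * (1 - cmod w))"
        using \<open>1 / 4 \<le> 1 - cmod w\<close> by simp
      finally show ?thesis .
    next
      case False
      define R where "R = 4 * (1 - cmod w)"
      have "S \<subseteq> {\<sigma> - R..\<sigma> + R}"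
      proof
        fix \<tau> assume \<tau>: "\<tau> \<in> S"
        have "\<bar>\<tau> - \<sigma>\<bar> * cmod z = dist (of_real \<tau> * z) (of_real \<sigma> * z)"
          by (simp add: dist_norm norm_mult flip: left_diff_distrib of_real_diff)
        also have "\<dots> \<le> dist (of_real \<tau> * z) w + dist (of_real \<sigma> * z) w"
          by (rule dist_triangle2)
        also have "\<dots> \<le> 2 * (1 - cmod w)" using near[OF \<sigma>] near[OF \<tau>] by simp
        finally have "\<bar>\<tau> - \<sigma>\<bar> * cmod z \<le> 2 * (1 - cmod w)" .
        moreover have "\<bar>\<tau> - \<sigma>\<bar> * (1 / 2) \<le> \<bar>\<tau> - \<sigma>\<bar> * cmod z"
          using False by (intro mult_left_mono) auto
        ultimately show "\<tau> \<in> {\<sigma> - R..\<sigma> + R}" by (auto simp: R_def)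
      qed
      then have "emeasure lborel S \<le> emeasure lborel {\<sigma> - R..\<sigma> + R}"
        by (intro emeasure_mono) auto
      also have "\<dots> = ennreal (8 * (1 - cmod w))"
        using w by (simp add: R_def)
      finally show ?thesis .
    qed
  qed simp
  finally show ?thesis .
qed

text \<open>Each value on the radius is bounded by a mean over a disc whose radius is half the
  distance to the unit circle. After exchanging the integrals, \<open>nn_integral_shadow_le\<close>
  supplies the factor that raises the exponent of \<open>1 - cmod w\<close> from
  \<open>p - 2\<close> to \<open>p - 1\<close>.\<close>

lemma nn_integral_radius_le_area:
  assumes F: "F holomorphic_on ball 0 1" and z: "cmod z < 1" and p: "1 \<le> p"
  shows "(\<integral>\<^sup>+\<tau>\<in>{0..<1}. ennreal (((1 - \<tau>) * cmod (F (of_real \<tau> * z))) powr p) \<partial>lborel) \<le>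
    ennreal (72 * 4 powr p / pi) *
    (\<integral>\<^sup>+w\<in>ball 0 1. ennreal (cmod (F w) powr p * (1 - cmod w) powr (p - 1)) \<partial>lborel)"
proof -
  define K where "K = 9 * 4 powr p / pi"
  have K: "0 \<le> K" by (simp add: K_def)
  define H where "H = (\<lambda>w. (indicator (ball 0 1) w *\<^sub>R cmod (F w)) powr p)"
  have [measurable]: "(\<lambda>w. indicator (ball 0 1) w *\<^sub>R cmod (F w)) \<in> borel_measurable borel"
    by (intro borel_measurable_continuous_on_indicator continuous_on_norm
        holomorphic_on_imp_continuous_on F) auto
  have [measurable]: "H \<in> borel_measurable borel" unfolding H_def by measurable
  have H: "H w = (if w \<in> ball 0 1 then cmod (F w) powr p else 0)" for w
    using p by (simp add: H_def)
  \<comment> \<open>The incidence of \<open>w\<close> with the disc belonging to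
    \<open>\<tau>\<close>, as a jointly measurable kernel so that the integrals can be
    exchanged.\<close>
  define N :: "real \<Rightarrow> complex \<Rightarrow> ennreal" where
    "N = (\<lambda>\<tau> w. if \<tau> \<in> {0..1} \<and> dist (of_real \<tau> * z) w < (1 - \<tau> * cmod z) / 2 then 1 else 0)"
  have [measurable]: "case_prod N \<in> borel_measurable (lborel \<Otimes>\<^sub>M lborel)"
    unfolding N_def by measurable
  have "(\<integral>\<^sup>+\<tau>\<in>{0..<1}. ennreal (((1 - \<tau>) * cmod (F (of_real \<tau> * z))) powr p) \<partial>lborel) \<le>
      (\<integral>\<^sup>+\<tau>. \<integral>\<^sup>+w. ennreal (K * (1 - cmod w) powr (p - 2) * H w) * N \<tau> w \<partial>lborel \<partial>lborel)"
  proof (rule nn_integral_mono)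
    fix \<tau> :: real
    show "ennreal (((1 - \<tau>) * cmod (F (of_real \<tau> * z))) powr p) * indicator {0..<1} \<tau> \<le>
      (\<integral>\<^sup>+w. ennreal (K * (1 - cmod w) powr (p - 2) * H w) * N \<tau> w \<partial>lborel)"
    proof (cases "\<tau> \<in> {0..<1}")
      case True
      define v where "v = of_real \<tau> * z"
      define \<delta> where "\<delta> = 1 - \<tau> * cmod z"
      have nv: "cmod v = 1 - \<delta>" using True by (simp add: v_def \<delta>_def norm_mult)
      have "\<tau> * cmod z \<le> \<tau> * 1" using z True by (intro mult_left_mono) auto
      then have \<delta>: "1 - \<tau> \<le> \<delta>" "0 < \<delta>" using True by (auto simp: \<delta>_def)
      have near: "\<bar>cmod w - (1 - \<delta>)\<bar> < \<delta> / 2" if "w \<in> ball v (\<delta> / 2)" for w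
        using that norm_triangle_ineq3[of v w] nv unfolding mem_ball dist_norm by linarith
      have sub: "ball v (\<delta> / 2) \<subseteq> ball 0 1"
      proof
        fix w assume "w \<in> ball v (\<delta> / 2)"
        from near[OF this] \<delta>(2) have "cmod w < 1" by linarith
        then show "w \<in> ball 0 1" by simp
      qed
      have "ennreal (((1 - \<tau>) * cmod (F v)) powr p) \<le> ennreal (\<delta> powr p) * ennreal (cmod (F v) powr p)"
        using True \<delta> p
        by (auto simp: ennreal_mult[symmetric] powr_mult intro!: ennreal_leI mult_right_mono powr_mono2)
      also have "\<dots> \<le> ennreal (\<delta> powr p) * (ennreal (2 powr p / (pi * (\<delta> / 2)\<^sup>2)) *
          (\<integral>\<^sup>+w\<in>ball v (\<delta> / 2). ennreal (cmod (F w) powr p) \<partial>lborel))"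
        using \<delta> p holomorphic_on_subset[OF F sub] by (intro mult_left_mono area_power_mean_bound) auto
      also have "\<dots> = (ennreal (\<delta> powr p) * ennreal (2 powr p / (pi * (\<delta> / 2)\<^sup>2))) *
          (\<integral>\<^sup>+w. ennreal (H w) * N \<tau> w \<partial>lborel)"
      proof -
        have "(\<integral>\<^sup>+w\<in>ball v (\<delta> / 2). ennreal (cmod (F w) powr p) \<partial>lborel) = (\<integral>\<^sup>+w. ennreal (H w) * N \<tau> w \<partial>lborel)"
          using sub True
          by (intro nn_integral_cong) (auto simp: H N_def v_def[symmetric] \<delta>_def[symmetric] indicator_def)
        then show ?thesis by (simp add: mult.assoc)
      qed
      also have "\<dots> = (\<integral>\<^sup>+w. (ennreal (\<delta> powr p) * ennreal (2 powr p / (pi * (\<delta> / 2)\<^sup>2))) * (ennreal (H w) * N \<tau> w) \<partial>lborel)"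
        by (rule nn_integral_cmult[symmetric]) measurable
      also have "\<dots> \<le> (\<integral>\<^sup>+w. ennreal (K * (1 - cmod w) powr (p - 2) * H w) * N \<tau> w \<partial>lborel)"
      proof (rule nn_integral_mono)
        fix w
        show "(ennreal (\<delta> powr p) * ennreal (2 powr p / (pi * (\<delta> / 2)\<^sup>2))) * (ennreal (H w) * N \<tau> w)
          \<le> ennreal (K * (1 - cmod w) powr (p - 2) * H w) * N \<tau> w"
        proof (cases "w \<in> ball v (\<delta> / 2)")
          case True
          define x where "x = 1 - cmod w"
          have "1 - x - (1 - \<delta>) < \<delta> / 2" "- (1 - x - (1 - \<delta>)) < \<delta> / 2"
            using near[OF True, unfolded abs_less_iff] by (auto simp: x_def)
          \<comment> \<open>The two distances are comparable. Bounding the power \<open>p\<close> of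
            \<open>\<delta>\<close> from above and its square from below separately avoids a case
            distinction on the sign of \<open>p - 2\<close>, and the factors collect to
            \<open>K\<close>.\<close>
          then have x: "\<delta> \<le> 2 * x" "x \<le> 3 / 2 * \<delta>" "0 < x" using \<delta> by auto
          have "\<delta> powr p * (2 powr p / (pi * (\<delta> / 2)\<^sup>2)) = 4 * 2 powr p / pi * (\<delta> powr p / \<delta>\<^sup>2)"
            by (simp add: power_divide)
          also have "\<dots> \<le> 4 * 2 powr p / pi * ((2 * x) powr p / (2 / 3 * x)\<^sup>2)"
            using x \<delta> p by (intro mult_left_mono frac_le powr_mono2 power_mono) auto
          also have "\<dots> = 9 * (2 powr p * 2 powr p) / pi * (x powr p / x\<^sup>2)"
            using x by (simp add: powr_mult power_divide power_mult_distrib)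
          also have "2 powr p * 2 powr p = 4 powr p"
            by (simp add: powr_mult[symmetric])
          also have "x powr p / x\<^sup>2 = x powr (p - 2)"
            using x by (simp add: powr_diff)
          finally have "\<delta> powr p * (2 powr p / (pi * (\<delta> / 2)\<^sup>2)) * H w \<le> K * x powr (p - 2) * H w"
            unfolding K_def by (intro mult_right_mono) (auto simp: H)
          then have "(ennreal (\<delta> powr p) * ennreal (2 powr p / (pi * (\<delta> / 2)\<^sup>2))) * ennreal (H w)
              \<le> ennreal (K * x powr (p - 2) * H w)"
            by (simp add: ennreal_mult[symmetric] ennreal_leI H)
          then show ?thesis unfolding x_def mult.assoc[symmetric] by (rule mult_right_mono) simp
        next
          case False
          then have "N \<tau> w = 0" by (auto simp: N_def v_def \<delta>_def)
          then show ?thesis by simp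
        qed
      qed
      finally show ?thesis using True by (simp add: v_def)
    qed simp
  qed
  also have "\<dots> = (\<integral>\<^sup>+w. \<integral>\<^sup>+\<tau>. ennreal (K * (1 - cmod w) powr (p - 2) * H w) * N \<tau> w \<partial>lborel \<partial>lborel)"
    by (rule lborel_pair.Fubini'[symmetric]) measurable
  also have "\<dots> \<le> (\<integral>\<^sup>+w. ennreal (8 * K) *
      (ennreal (cmod (F w) powr p * (1 - cmod w) powr (p - 1)) * indicator (ball 0 1) w) \<partial>lborel)"
  proof (rule nn_integral_mono)
    fix w :: complex
    show "(\<integral>\<^sup>+\<tau>. ennreal (K * (1 - cmod w) powr (p - 2) * H w) * N \<tau> w \<partial>lborel) \<le> ennreal (8 * K) *
      (ennreal (cmod (F w) powr p * (1 - cmod w) powr (p - 1)) * indicator (ball 0 1) w)"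
    proof (cases "w \<in> ball 0 1")
      case True
      have "(\<integral>\<^sup>+\<tau>. ennreal (K * (1 - cmod w) powr (p - 2) * H w) * N \<tau> w \<partial>lborel)
        = ennreal (K * (1 - cmod w) powr (p - 2) * H w) * (\<integral>\<^sup>+\<tau>. N \<tau> w \<partial>lborel)"
        by (rule nn_integral_cmult) (simp add: N_def)
      also have "\<dots> \<le> ennreal (K * (1 - cmod w) powr (p - 2) * H w) * ennreal (8 * (1 - cmod w))"
        unfolding N_def using True by (intro mult_left_mono nn_integral_shadow_le z) auto
      also have "\<dots> = ennreal (K * (1 - cmod w) powr (p - 2) * H w * (8 * (1 - cmod w)))"
        using True by (subst ennreal_mult'') auto
      also have "K * (1 - cmod w) powr (p - 2) * H w * (8 * (1 - cmod w))
          = 8 * K * (cmod (F w) powr p * (1 - cmod w) powr (p - 1))"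
      proof -
        have "(1 - cmod w) powr (p - 1) = (1 - cmod w) powr (p - 2) * (1 - cmod w)"
          using True powr_add[of "1 - cmod w" "p - 2" 1] by simp
        then show ?thesis using True by (simp add: H mult_ac)
      qed
      finally show ?thesis using True K by (simp add: ennreal_mult)
    qed (simp add: H)
  qed
  also have "\<dots> = ennreal (8 * K) *
    (\<integral>\<^sup>+w\<in>ball 0 1. ennreal (cmod (F w) powr p * (1 - cmod w) powr (p - 1)) \<partial>lborel)"
  proof (rule nn_integral_cmult)
    have "(\<lambda>w. ennreal (H w * (1 - cmod w) powr (p - 1))) \<in> borel_measurable lborel" by measurable
    also have "(\<lambda>w. ennreal (H w * (1 - cmod w) powr (p - 1))) =
      (\<lambda>w. ennreal (cmod (F w) powr p * (1 - cmod w) powr (p - 1)) * indicator (ball 0 1) w)"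
      by (auto simp: H indicator_def)
    finally show "(\<lambda>w. ennreal (cmod (F w) powr p * (1 - cmod w) powr (p - 1)) * indicator (ball 0 1) w) \<in> borel_measurable lborel" .
  qed
  finally show ?thesis by (simp add: K_def)
qed

section \<open>Chord estimates and the bound for \<open>H^p\<close>\<close>

text \<open>Up to \<open>1 / 3\<close> the mean value theorem applies with
  \<open>cos \<ge> 1 / 2\<close> and \<open>pi \<ge> 2\<close>; beyond, the sine is at least
  \<open>sqrt 3 / 2\<close>, which exceeds \<open>1 / 2\<close>.\<close>

lemma sin_pi_ge:
  assumes "0 \<le> d" "d \<le> 1 / 2"
  shows "d \<le> sin (pi * d)"
proof (cases "d = 0 \<or> 1 / 3 < d")
  case False
  then have d: "0 < pi * d" "pi * d \<le> pi / 3" using assms by auto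
  obtain x where x: "0 < x" "x < pi * d" "sin (pi * d) - sin 0 = (pi * d - 0) * cos x"
    using MVT2[OF d(1), of sin cos] by auto
  have "x \<le> pi / 3" using x d by linarith
  then have "cos (pi / 3) \<le> cos x" using x by (intro cos_monotone_0_pi_le) auto
  then have "pi * d * (1 / 2) \<le> pi * d * cos x" using d by (intro mult_left_mono) (auto simp: cos_60)
  moreover have "2 * d \<le> pi * d" using pi_ge_two assms by (intro mult_right_mono) auto
  moreover have "sin (pi * d) = pi * d * cos x" using x(3) by simp
  ultimately show ?thesis by linarith
next
  case True
  show ?thesis
  proof (cases "d = 0")
    case False
    have "- (pi / 2) \<le> pi / 3" using pi_gt_zero by linarith
    then have "sin (pi / 3) \<le> sin (pi * d)"
      using False True assms by (intro sin_monotone_2pi_le) auto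
    moreover have "1 / 2 \<le> sqrt 3 / 2" by simp
    ultimately show ?thesis using assms(2) unfolding sin_60 by linarith
  qed simp
qed

text \<open>The chord has length \<open>2 * \<bar>sin (pi * (x - \<alpha>))\<bar>\<close>. Since
  \<open>\<bar>sin (pi * y)\<bar>\<close> is even and has period 1 in \<open>y\<close>, the
  difference may be replaced by \<open>circ_dist\<close>, where \<open>sin_pi_ge\<close>
  applies.\<close>

lemma circ_dist_le_cis:
  assumes "\<alpha> \<in> {0..1}" "x \<in> {0..1}"
  shows "2 * circ_dist \<alpha> x \<le> cmod (1 - cis (2 * pi * (\<alpha> - x)))"
proof -
  define d where "d = circ_dist \<alpha> x"
  have d: "0 \<le> d" "d \<le> 1 / 2" using assms by (auto simp: d_def circ_dist_def min_def)
  consider "d = \<bar>x - \<alpha>\<bar>" | "d = \<bar>x - \<alpha> - 1\<bar>" | "d = \<bar>x - \<alpha> + 1\<bar>"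
    unfolding d_def circ_dist_def min_def by (smt (verit))
  then have "\<bar>sin (pi * d)\<bar> = \<bar>sin (pi * (x - \<alpha>))\<bar>"
  proof cases
    case 1
    then show ?thesis by (auto simp: abs_if sin_diff algebra_simps)
  next
    case 2
    then show ?thesis by (auto simp: abs_if sin_diff sin_add algebra_simps)
  next
    case 3
    then show ?thesis by (auto simp: abs_if sin_diff sin_add algebra_simps)
  qed
  moreover have "cmod (1 - cis (2 * pi * (\<alpha> - x))) = 2 * \<bar>sin (pi * (x - \<alpha>))\<bar>"
  proof -
    define y where "y = pi * (\<alpha> - x)"
    have "(cmod (1 - cis (2 * y)))\<^sup>2 = (1 - cos (2 * y))\<^sup>2 + (sin (2 * y))\<^sup>2"
      by (simp add: cmod_power2)
    also have "\<dots> = 2 - 2 * cos (2 * y)"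
      using sin_cos_squared_add[of "2 * y"] by (simp add: power2_diff)
    also have "\<dots> = (2 * \<bar>sin y\<bar>)\<^sup>2"
      by (simp add: cos_double_sin)
    finally have "cmod (1 - cis (2 * y)) = 2 * \<bar>sin y\<bar>"
      by (rule power2_eq_imp_eq) auto
    moreover have "\<bar>sin (pi * (x - \<alpha>))\<bar> = \<bar>sin y\<bar>"
      using sin_minus[of y] by (simp add: y_def algebra_simps)
    ultimately show ?thesis by (simp add: y_def mult.assoc)
  qed
  ultimately show ?thesis using sin_pi_ge[OF d] by (simp add: d_def)
qed

text \<open>Dividing by the point on the circle leaves \<open>1 - s * c\<close> with
  \<open>s \<le> t\<close> and \<open>c\<close> unimodular. Its modulus is at least
  \<open>1 - s\<close>, hence at least \<open>1 - t\<close>; it is also at least half the chord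
  \<open>cmod (1 - c)\<close>, since \<open>1 - c\<close> differs from it by \<open>1 - s\<close> in
  modulus. The bound does not depend on \<open>r\<close>.\<close>

lemma cauchy_kernel_bound:
  assumes \<alpha>: "\<alpha> \<in> {0..1}" and x: "x \<in> {0..1}" and t: "0 \<le> t" "t < 1" and z: "z = of_real (cmod z) * cis (2 * pi * \<alpha>)"
    and r: "cmod z < r"
  shows "r / cmod (of_real r * cis (2 * pi * x) - of_real t * z) \<le> 2 / ((1 - t) + circ_dist \<alpha> x)"
proof -
  define s where "s = t * (cmod z / r)"
  have r0: "0 < r" using r by (smt (verit) norm_ge_zero)
  have st: "0 \<le> s" "s \<le> t"
    using r0 r t mult_left_mono[of "cmod z / r" 1 t] by (auto simp: s_def)
  define c where "c = cis (2 * pi * (\<alpha> - x))"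
  have nc: "cmod c = 1" by (simp add: c_def)
  have "of_real r * cis (2 * pi * x) - of_real t * z = of_real r * cis (2 * pi * x) * (1 - of_real s * c)"
  proof -
    have "cis (2 * pi * x) * c = cis (2 * pi * \<alpha>)"
      by (simp add: c_def cis_mult algebra_simps)
    moreover have "of_real r * of_real s = (of_real t * of_real (cmod z) :: complex)"
    proof -
      have "r * s = t * cmod z" using r0 by (simp add: s_def)
      then show ?thesis by (simp only: of_real_mult[symmetric])
    qed
    ultimately have "of_real r * cis (2 * pi * x) * (of_real s * c) = of_real t * (of_real (cmod z) * cis (2 * pi * \<alpha>))"
      by (metis mult.assoc mult.commute)
    then show ?thesis by (simp add: right_diff_distrib z[symmetric])
  qed
  then have n: "cmod (of_real r * cis (2 * pi * x) - of_real t * z) = r * cmod (1 - of_real s * c)"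
    using r0 by (simp add: norm_mult)
  have 1: "1 - t \<le> cmod (1 - of_real s * c)"
    using norm_triangle_ineq2[of 1 "of_real s * c"] st nc by (simp add: norm_mult)
  have "cmod (1 - c) \<le> cmod (1 - of_real s * c) + cmod (of_real s * c - c)"
    using norm_triangle_ineq[of "1 - of_real s * c" "of_real s * c - c"] by simp
  moreover have "cmod (of_real s * c - c) = 1 - s"
  proof -
    have "of_real s * c - c = of_real (s - 1) * c" by (simp add: algebra_simps)
    then show ?thesis using st t nc by (simp only: norm_mult norm_of_real) simp
  qed
  moreover have "1 - s \<le> cmod (1 - of_real s * c)"
    using norm_triangle_ineq2[of 1 "of_real s * c"] st nc by (simp add: norm_mult)
  ultimately have "circ_dist \<alpha> x \<le> cmod (1 - of_real s * c)"
    using circ_dist_le_cis[OF \<alpha> x] by (simp add: c_def)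
  with 1 have le: "((1 - t) + circ_dist \<alpha> x) / 2 \<le> cmod (1 - of_real s * c)" by simp
  moreover have pos: "0 < ((1 - t) + circ_dist \<alpha> x) / 2" using t circ_dist_nonneg[of \<alpha> x] by simp
  ultimately have "1 / cmod (1 - of_real s * c) \<le> 1 / (((1 - t) + circ_dist \<alpha> x) / 2)"
    by (intro divide_left_mono mult_pos_pos) auto
  then show ?thesis using r0 unfolding n by simp
qed

text \<open>Rescaling the angle to \<open>[0, 1]\<close> absorbs the normalisation
  \<open>1 / (2 * pi)\<close>.\<close>

lemma hardy_norm_circle:
  assumes f: "f holomorphic_on ball 0 1" and p: "0 < p" and A: "0 < A" "hardy_norm p f \<le> ennreal A"
    and r: "0 < r" "r < 1"
  shows "(\<integral>\<^sup>+x\<in>{0..1}. ennreal (cmod (f (of_real r * cis (2 * pi * x))) powr p) \<partial>lborel) \<le> ennreal (A powr p)"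
proof -
  define F where "F = (\<lambda>\<theta>. ennreal (cmod (f (of_real r * cis \<theta>)) powr p) * indicator {0..2 * pi} \<theta>)"
  have "continuous_on UNIV (\<lambda>\<theta>. f (of_real r * cis \<theta>))"
    by (rule continuous_on_compose2[OF holomorphic_on_imp_continuous_on[OF f]])
       (use r in \<open>auto intro!: continuous_intros simp: norm_mult\<close>)
  then have [measurable]: "(\<lambda>\<theta>. f (of_real r * cis \<theta>)) \<in> borel_measurable borel"
    by (rule borel_measurable_continuous_onI)
  have [measurable]: "F \<in> borel_measurable borel" unfolding F_def by measurable
  have "hardy_mean p r f \<le> ennreal A"
    using A(2) r by (auto simp: hardy_norm_def SUP_le_iff)
  then have "ennreal (1 / (2 * pi)) * (\<integral>\<^sup>+\<theta>. F \<theta> \<partial>lborel) \<le> ennreal (A powr p)"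
    using p A(1) by (simp add: hardy_mean_def epowr_inverse_le_iff F_def)
  also have "(\<integral>\<^sup>+\<theta>. F \<theta> \<partial>lborel) = ennreal (2 * pi) * (\<integral>\<^sup>+x. F (2 * pi * x) \<partial>lborel)"
    using nn_integral_real_affine[of F "2 * pi" 0] by simp
  also have "ennreal (1 / (2 * pi)) * (ennreal (2 * pi) * (\<integral>\<^sup>+x. F (2 * pi * x) \<partial>lborel)) = (\<integral>\<^sup>+x. F (2 * pi * x) \<partial>lborel)"
    by (simp add: mult.assoc[symmetric] ennreal_mult[symmetric])
  also have "\<dots> = (\<integral>\<^sup>+x\<in>{0..1}. ennreal (cmod (f (of_real r * cis (2 * pi * x))) powr p) \<partial>lborel)"
  proof (rule nn_integral_cong)
    fix x :: real
    have pi_neg: "\<not> pi \<le> 0" using pi_gt_zero by (simp only: not_le)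
    have "2 * pi * x \<in> {0..2 * pi} \<longleftrightarrow> x \<in> {0..1}"
      using pi_neg by (auto simp: mult_le_cancel_left1 zero_le_mult_iff)
    then show "F (2 * pi * x) = ennreal (cmod (f (of_real r * cis (2 * pi * x))) powr p) * indicator {0..1} x"
      by (simp add: F_def indicator_def)
  qed
  finally show ?thesis .
qed

text \<open>Cauchy's formula replaces the values on the radius by values on a circle, and the kernel
  bound makes the resulting double integral one of Hilbert type.\<close>

lemma T_op_bound_hardy:
  assumes p: "1 < p" "1 / p + 1 / q = 1"
    and f: "f holomorphic_on ball 0 1" and g: "g holomorphic_on ball 0 1"
    and A: "0 < A" "hardy_norm p f \<le> ennreal A"
    and B: "0 < B" "coeff_sum q g \<le> ennreal (B powr q)" and z: "cmod z < 1"
  shows "ennreal (cmod (T_op g f z)) \<le> ennreal (24 * exp 1 * (p + q) * A * B)"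
proof -
  have q: "1 < q" using p by (rule conjugate_exponent_gt_1)
  have fin: "coeff_sum q g < \<infinity>" using B(2) by (rule le_less_trans) simp
  \<comment> \<open>Any such radius serves, as every later estimate is uniform in \<open>r\<close>;
    boundary values of \<open>f\<close> are thus avoided.\<close>
  obtain r where r: "cmod z < r" "r < 1" using dense[OF z] by auto
  have r0: "0 < r" using r by (smt (verit) norm_ge_zero)
  define \<alpha> where "\<alpha> = Arg2pi z / (2 * pi)"
  have \<alpha>: "\<alpha> \<in> {0..1}" "z = of_real (cmod z) * cis (2 * pi * \<alpha>)"
  proof -
    show "\<alpha> \<in> {0..1}" using Arg2pi[of z] by (auto simp: \<alpha>_def field_simps less_imp_le)
    have "2 * pi * \<alpha> = Arg2pi z" by (simp add: \<alpha>_def)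
    then show "z = of_real (cmod z) * cis (2 * pi * \<alpha>)"
      using Arg2pi_eq[of z] by (simp only: cis_conv_exp)
  qed
  define u where "u = (\<lambda>x. indicator {0..1} x * cmod (f (of_real r * cis (2 * pi * x))))"
  \<comment> \<open>The 2 is the numerator of \<open>cauchy_kernel_bound\<close>; with the bound
    \<open>2 * exp 1 * B\<close> for the step function it yields \<open>4 * exp 1 * B\<close>
    below.\<close>
  define w where "w = (\<lambda>t. 2 * tail_weight g t)"
  have "continuous_on UNIV (\<lambda>x. f (of_real r * cis (2 * pi * x)))"
    by (rule continuous_on_compose2[OF holomorphic_on_imp_continuous_on[OF f]])
       (use r r0 in \<open>auto intro!: continuous_intros simp: norm_mult\<close>)
  then have [measurable]: "(\<lambda>x. f (of_real r * cis (2 * pi * x))) \<in> borel_measurable borel"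
    by (rule borel_measurable_continuous_onI)
  have [measurable]: "u \<in> borel_measurable borel" "w \<in> borel_measurable borel"
    unfolding u_def w_def by measurable
  have "AE t in lborel. t \<noteq> (1::real)" by (rule AE_lborel_singleton)
  have "ennreal (cmod (T_op g f z)) \<le> (\<integral>\<^sup>+t\<in>{0..1}. ennreal (cmod (f (of_real t * z))) * dmajorant g t \<partial>lborel)"
    by (rule T_op_le_nn_integral[OF f g z])
  also have "\<dots> \<le> (\<integral>\<^sup>+t. \<integral>\<^sup>+x. ennreal (u x * w t / ((1 - t) + circ_dist \<alpha> x)) \<partial>lborel \<partial>lborel)"
  proof (rule nn_integral_mono_AE, use \<open>AE t in lborel. t \<noteq> (1::real)\<close> in eventually_elim)
    case (elim t)
    show ?case
    proof (cases "t \<in> {0..1}")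
      case True
      with elim have t: "0 \<le> t" "t < 1" by auto
      have "cmod (of_real t * z) \<le> 1 * cmod z"
        unfolding norm_mult using t by (intro mult_right_mono) auto
      then have mem: "of_real t * z \<in> ball 0 r" using r by simp
      have "ennreal (cmod (f (of_real t * z))) \<le> (\<integral>\<^sup>+x\<in>{0..1}. ennreal (cmod (f (0 + of_real r * cis (2 * pi * x))) *
        (r / cmod (0 + of_real r * cis (2 * pi * x) - of_real t * z))) \<partial>lborel)"
        using r by (intro cauchy_circle_bound[OF f _ _ mem]) auto
      also have "\<dots> \<le> (\<integral>\<^sup>+x. ennreal (u x * (2 / ((1 - t) + circ_dist \<alpha> x))) \<partial>lborel)"
      proof (rule nn_integral_mono)
        fix x :: real
        show "ennreal (cmod (f (0 + of_real r * cis (2 * pi * x))) *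
            (r / cmod (0 + of_real r * cis (2 * pi * x) - of_real t * z))) * indicator {0..1} x
          \<le> ennreal (u x * (2 / ((1 - t) + circ_dist \<alpha> x)))"
          using cauchy_kernel_bound[OF \<alpha>(1) _ t \<alpha>(2) r(1), of x]
          by (auto simp: u_def indicator_def simp del: times_divide_eq_right intro!: ennreal_leI mult_left_mono)
      qed
      finally have 1: "ennreal (cmod (f (of_real t * z))) \<le> (\<integral>\<^sup>+x. ennreal (u x * (2 / ((1 - t) + circ_dist \<alpha> x))) \<partial>lborel)" .
      have "ennreal (cmod (f (of_real t * z))) * dmajorant g t \<le>
         (\<integral>\<^sup>+x. ennreal (u x * (2 / ((1 - t) + circ_dist \<alpha> x))) \<partial>lborel) * ennreal (tail_weight g t)"
        by (intro mult_mono 1 dmajorant_le_tail_weight dmoment_finite[OF fin] t) auto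
      also have "\<dots> = (\<integral>\<^sup>+x. ennreal (u x * (2 / ((1 - t) + circ_dist \<alpha> x))) * ennreal (tail_weight g t) \<partial>lborel)"
        by (rule nn_integral_multc[symmetric]) measurable
      also have "\<dots> = (\<integral>\<^sup>+x. ennreal (u x * w t / ((1 - t) + circ_dist \<alpha> x)) \<partial>lborel)"
        using t circ_dist_nonneg
        by (intro nn_integral_cong) (simp add: ennreal_mult'[symmetric] tail_weight_nonneg w_def mult_ac)
      finally show ?thesis using True by simp
    qed simp
  qed
  also have "\<dots> \<le> ennreal (6 * (p + q) * A * (4 * exp 1 * B))"
  proof (rule hilbert_type_inequality[OF p])
    have "(\<integral>\<^sup>+x. ennreal (u x powr p) \<partial>lborel)
        = (\<integral>\<^sup>+x\<in>{0..1}. ennreal (cmod (f (of_real r * cis (2 * pi * x))) powr p) \<partial>lborel)"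
      using p(1) by (intro nn_integral_cong) (auto simp: u_def indicator_def)
    also have "\<dots> \<le> ennreal (A powr p)"
      using hardy_norm_circle[OF f _ A r0 r(2)] p(1) by simp
    finally show "(\<integral>\<^sup>+x. ennreal (u x powr p) \<partial>lborel) \<le> ennreal (A powr p)" .
    have "(\<integral>\<^sup>+t. ennreal (w t powr q) \<partial>lborel) = ennreal (2 powr q) * (\<integral>\<^sup>+t. ennreal (tail_weight g t powr q) \<partial>lborel)"
      by (subst nn_integral_cmult[symmetric])
         (auto simp: w_def powr_mult tail_weight_nonneg ennreal_mult)
    also have "\<dots> \<le> ennreal (2 powr q) * ennreal ((2 * exp 1 * B) powr q)"
      using q B by (intro mult_left_mono nn_integral_tail_weight_le) auto
    also have "\<dots> = ennreal ((4 * exp 1 * B) powr q)"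
      using B(1) by (simp add: ennreal_mult[symmetric] powr_mult[symmetric] mult.assoc[symmetric])
    finally show "(\<integral>\<^sup>+t. ennreal (w t powr q) \<partial>lborel) \<le> ennreal ((4 * exp 1 * B) powr q)" .
    show "w t = 0" if "1 \<le> t" for t using that by (simp add: w_def tail_weight_def)
  qed (use A B in \<open>auto simp: u_def w_def tail_weight_nonneg\<close>)
  finally show ?thesis by (simp add: mult_ac)
qed

section \<open>The bound for \<open>D^p_{p-1}\<close>\<close>

lemma cmod_radius_le_integral_deriv:
  assumes f: "f holomorphic_on ball 0 1" and z: "cmod z < 1" and t: "t \<in> {0..1}"
  shows "ennreal (cmod (f (of_real t * z))) \<le>
    ennreal (cmod (f 0)) + (\<integral>\<^sup>+\<tau>\<in>{0..t}. ennreal (cmod (deriv f (of_real \<tau> * z))) \<partial>lborel)"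
proof -
  have mem: "of_real \<tau> * z \<in> ball 0 1" if "\<tau> \<in> {0..t}" for \<tau>
    using that t z mult_right_mono[of \<tau> 1 "cmod z"] by (auto simp: norm_mult)
  have df: "deriv f holomorphic_on ball 0 1" using f by (intro holomorphic_deriv) auto
  define h where "h = (\<lambda>\<tau>. deriv f (of_real \<tau> * z) * z)"
  have cont: "continuous_on {0..t} h"
    unfolding h_def
    by (intro continuous_intros continuous_on_compose2[OF holomorphic_on_imp_continuous_on[OF df]])
       (use mem in auto)
  have "(h has_integral f (of_real t * z) - f (of_real 0 * z)) {0..t}"
  proof (rule fundamental_theorem_of_calculus)
    fix \<tau> assume \<tau>: "\<tau> \<in> {0..t}"
    have "(f has_field_derivative deriv f (of_real \<tau> * z)) (at (of_real \<tau> * z))"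
      using holomorphic_derivI[OF f open_ball mem[OF \<tau>]] .
    then have "((\<lambda>x. f (x * z)) has_field_derivative deriv f (of_real \<tau> * z) * z) (at (of_real \<tau>))"
      by (rule DERIV_chain2) (auto intro!: derivative_eq_intros)
    then show "((\<lambda>\<tau>. f (of_real \<tau> * z)) has_vector_derivative h \<tau>) (at \<tau> within {0..t})"
      unfolding h_def by (rule has_vector_derivative_real_field)
  qed (use t in auto)
  then have eq: "integral {0..t} h = f (of_real t * z) - f 0" by (simp add: integral_unique)
  have "cmod (f (of_real t * z)) \<le> cmod (f 0) + cmod (integral {0..t} h)"
    unfolding eq using norm_triangle_ineq[of "f 0" "f (of_real t * z) - f 0"] by simp
  then have "ennreal (cmod (f (of_real t * z))) \<le> ennreal (cmod (f 0)) + ennreal (cmod (integral {0..t} h))"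
    by (rule ennreal_le_plus) auto
  also have "ennreal (cmod (integral {0..t} h)) \<le> (\<integral>\<^sup>+\<tau>\<in>{0..t}. ennreal (cmod (h \<tau>)) \<partial>lborel)"
    by (rule norm_integral_le_nn_integral[OF cont])
  also have "\<dots> \<le> (\<integral>\<^sup>+\<tau>\<in>{0..t}. ennreal (cmod (deriv f (of_real \<tau> * z))) \<partial>lborel)"
    using z by (intro nn_integral_mono mult_right_mono ennreal_leI)
       (auto simp: h_def norm_mult intro!: mult_left_le)
  finally show ?thesis by (simp add: add_left_mono)
qed

lemma T_op_bound_dirichlet:
  assumes p: "1 < p" "1 / p + 1 / q = 1"
    and f: "f holomorphic_on ball 0 1" and g: "g holomorphic_on ball 0 1"
    and A: "0 < A" "dirichlet_norm p f \<le> ennreal A"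
    and B: "0 < B" "coeff_sum q g \<le> ennreal (B powr q)" and z: "cmod z < 1"
  shows "ennreal (cmod (T_op g f z)) \<le> ennreal ((1 + 576 * exp 1) * A * B)"
proof -
  have q: "1 < q" using p by (rule conjugate_exponent_gt_1)
  have fin: "coeff_sum q g < \<infinity>" using B(2) by (rule le_less_trans) simp
  have df: "deriv f holomorphic_on ball 0 1" using f by (intro holomorphic_deriv) auto
  define J where "J = (\<integral>\<^sup>+w\<in>ball 0 1. ennreal (cmod (deriv f w) powr p * (1 - cmod w) powr (p - 1)) \<partial>lborel)"
  have norm: "ennreal (1 / pi) * J + ennreal (cmod (f 0) powr p) \<le> ennreal (A powr p)"
    using A p(1) unfolding dirichlet_norm_def J_def by (subst (asm) epowr_inverse_le_iff) auto
  have J: "ennreal (1 / pi) * J \<le> ennreal (A powr p)"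
    using order_trans[OF _ norm] by (simp add: add_increasing2)
  have "ennreal (cmod (f 0) powr p) \<le> ennreal (A powr p)"
    using order_trans[OF _ norm] by (simp add: add_increasing)
  then have f0: "cmod (f 0) \<le> A"
    using p(1) A(1) powr_less_mono2[of p A "cmod (f 0)"] by (force simp: not_le[symmetric])
  define v where "v = (\<lambda>\<tau>. indicator {0..1} \<tau> *\<^sub>R cmod (deriv f (of_real \<tau> * z)))"
  have "continuous_on {0..1} (\<lambda>\<tau>. deriv f (of_real \<tau> * z))"
  proof (rule continuous_on_compose2[OF holomorphic_on_imp_continuous_on[OF df]])
    show "(\<lambda>\<tau>. of_real \<tau> * z) ` {0..1} \<subseteq> ball 0 1"
      using z mult_right_mono[of _ 1 "cmod z"] by (force simp: norm_mult)
  qed (intro continuous_intros)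
  then have [measurable]: "v \<in> borel_measurable borel"
    unfolding v_def by (intro borel_measurable_continuous_on_indicator continuous_on_norm) auto
  have v: "0 \<le> v \<tau>" for \<tau> by (simp add: v_def)
  \<comment> \<open>The factor \<open>1 - \<tau>\<close> from the tail integral is attached to the
    derivative, leaving \<open>tail_weight\<close> alone as the second Hoelder factor.\<close>
  define u where "u = (\<lambda>\<tau>. indicator {0..<1} \<tau> * ((1 - \<tau>) * v \<tau>))"
  have [measurable]: "u \<in> borel_measurable borel" unfolding u_def by measurable
  \<comment> \<open>The order relation between the two parameters as a kernel; exchanging the
    integrals turns integration over \<open>\<tau> \<le> t\<close> into the tail integral of the
    majorant.\<close>
  define N :: "real \<Rightarrow> real \<Rightarrow> ennreal" where "N = (\<lambda>t \<tau>. if \<tau> \<le> t \<and> t \<le> 1 then 1 else 0)"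
  have [measurable]: "case_prod N \<in> borel_measurable (lborel \<Otimes>\<^sub>M lborel)" unfolding N_def by measurable
  have ne: "AE \<tau> in lborel. \<tau> \<noteq> (1::real)" by (rule AE_lborel_singleton)
  have "ennreal (cmod (T_op g f z)) \<le> (\<integral>\<^sup>+t\<in>{0..1}. ennreal (cmod (f (of_real t * z))) * dmajorant g t \<partial>lborel)"
    by (rule T_op_le_nn_integral[OF f g z])
  also have "\<dots> \<le> (\<integral>\<^sup>+t. ennreal (cmod (f 0)) * (ennreal (t ^ 0) * dmajorant g t * indicator {0..1} t) +
      (\<integral>\<^sup>+\<tau>. ennreal (v \<tau>) * (dmajorant g t * N t \<tau>) \<partial>lborel) \<partial>lborel)"
  proof (rule nn_integral_mono)
    fix t :: real
    show "ennreal (cmod (f (of_real t * z))) * dmajorant g t * indicator {0..1} t \<le>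
      ennreal (cmod (f 0)) * (ennreal (t ^ 0) * dmajorant g t * indicator {0..1} t) +
      (\<integral>\<^sup>+\<tau>. ennreal (v \<tau>) * (dmajorant g t * N t \<tau>) \<partial>lborel)"
    proof (cases "t \<in> {0..1}")
      case True
      have "ennreal (cmod (f (of_real t * z))) * dmajorant g t \<le> (ennreal (cmod (f 0)) +
          (\<integral>\<^sup>+\<tau>\<in>{0..t}. ennreal (cmod (deriv f (of_real \<tau> * z))) \<partial>lborel)) * dmajorant g t"
        by (intro mult_right_mono cmod_radius_le_integral_deriv f z True) auto
      also have "(\<integral>\<^sup>+\<tau>\<in>{0..t}. ennreal (cmod (deriv f (of_real \<tau> * z))) \<partial>lborel)
          = (\<integral>\<^sup>+\<tau>. ennreal (v \<tau>) * N t \<tau> \<partial>lborel)"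
        using True by (intro nn_integral_cong) (auto simp: v_def N_def indicator_def)
      also have "(ennreal (cmod (f 0)) + (\<integral>\<^sup>+\<tau>. ennreal (v \<tau>) * N t \<tau> \<partial>lborel)) * dmajorant g t =
        ennreal (cmod (f 0)) * dmajorant g t + (\<integral>\<^sup>+\<tau>. ennreal (v \<tau>) * N t \<tau> * dmajorant g t \<partial>lborel)"
        by (simp add: distrib_right nn_integral_multc N_def)
      finally show ?thesis using True by (simp add: mult_ac)
    qed simp
  qed
  also have "\<dots> = ennreal (cmod (f 0)) * dmoment g 0 +
      (\<integral>\<^sup>+t. \<integral>\<^sup>+\<tau>. ennreal (v \<tau>) * (dmajorant g t * N t \<tau>) \<partial>lborel \<partial>lborel)"
  proof -
    have "(\<integral>\<^sup>+t. ennreal (cmod (f 0)) * (ennreal (t ^ 0) * dmajorant g t * indicator {0..1} t) \<partial>lborel)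
        = ennreal (cmod (f 0)) * dmoment g 0"
      unfolding nn_integral_power_dmajorant[symmetric] by (rule nn_integral_cmult) measurable
    then show ?thesis by (subst nn_integral_add; (measurable; fail)?)
  qed
  \<comment> \<open>The first summand comes from \<open>f 0\<close>. In the second,
    \<open>288 = 72 * 4\<close> comes from \<open>nn_integral_radius_le_area\<close> and
    \<open>2 * exp 1\<close> from the step function.\<close>
  also have "\<dots> \<le> ennreal A * ennreal B + ennreal (288 * A * (2 * exp 1 * B))"
  proof (intro add_mono mult_mono)
    show "dmoment g 0 \<le> ennreal B" using q B by (intro dmoment_0_le[of q]) auto
    have "(\<integral>\<^sup>+t. \<integral>\<^sup>+\<tau>. ennreal (v \<tau>) * (dmajorant g t * N t \<tau>) \<partial>lborel \<partial>lborel)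
        = (\<integral>\<^sup>+\<tau>. \<integral>\<^sup>+t. ennreal (v \<tau>) * (dmajorant g t * N t \<tau>) \<partial>lborel \<partial>lborel)"
      by (rule lborel_pair.Fubini'[symmetric]) measurable
    also have "\<dots> \<le> (\<integral>\<^sup>+\<tau>. ennreal (u \<tau> * tail_weight g \<tau>) \<partial>lborel)"
    proof (rule nn_integral_mono_AE, use ne in eventually_elim)
      case (elim \<tau>)
      have "(\<integral>\<^sup>+t. ennreal (v \<tau>) * (dmajorant g t * N t \<tau>) \<partial>lborel)
         = ennreal (v \<tau>) * (\<integral>\<^sup>+t\<in>{\<tau>..1}. dmajorant g t \<partial>lborel)"
        by (subst nn_integral_cmult[symmetric])
           (auto intro!: nn_integral_cong simp: N_def indicator_def)
      also have "\<dots> \<le> ennreal (u \<tau> * tail_weight g \<tau>)"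
      proof (cases "\<tau> \<in> {0..<1}")
        case True
        then have "ennreal (v \<tau>) * (\<integral>\<^sup>+t\<in>{\<tau>..1}. dmajorant g t \<partial>lborel)
            \<le> ennreal (v \<tau>) * ennreal ((1 - \<tau>) * tail_weight g \<tau>)"
          using dmoment_finite[OF fin]
          by (intro mult_left_mono tail_integral_le_tail_weight) auto
        then show ?thesis using True v tail_weight_nonneg[of g \<tau>]
          by (simp add: ennreal_mult[symmetric] u_def mult_ac)
      next
        case False
        then have "v \<tau> = 0" using elim by (auto simp: v_def indicator_def)
        then show ?thesis by simp
      qed
      finally show ?case .
    qed
    also have "\<dots> \<le> ennreal (288 * A * (2 * exp 1 * B))"
    proof (rule nn_integral_Hoelder[OF p])
      have "(\<integral>\<^sup>+\<tau>. ennreal (u \<tau> powr p) \<partial>lborel) =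
        (\<integral>\<^sup>+\<tau>\<in>{0..<1}. ennreal (((1 - \<tau>) * cmod (deriv f (of_real \<tau> * z))) powr p) \<partial>lborel)"
        using p(1) by (intro nn_integral_cong) (auto simp: u_def v_def indicator_def)
      also have "\<dots> \<le> ennreal (72 * 4 powr p / pi) * J"
        unfolding J_def using p(1) by (intro nn_integral_radius_le_area df z) auto
      also have "\<dots> = ennreal (72 * 4 powr p) * (ennreal (1 / pi) * J)"
        by (simp add: mult.assoc[symmetric] ennreal_mult[symmetric])
      also have "\<dots> \<le> ennreal (72 * 4 powr p) * ennreal (A powr p)"
        by (intro mult_left_mono J) auto
      also have "\<dots> = ennreal (72 * (4 powr p * A powr p))"
        by (simp add: ennreal_mult[symmetric] mult.assoc)
      also have "\<dots> \<le> ennreal ((288 * A) powr p)"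
      proof (rule ennreal_leI)
        \<comment> \<open>Enlarging 72 to its \<open>p\<close>-th power moves the whole constant
          inside the power.\<close>
        have "(72::real) powr 1 \<le> 72 powr p" using p(1) by (intro powr_mono) auto
        then have "72 * (4 powr p * A powr p) \<le> 72 powr p * (4 powr p * A powr p)"
          by (intro mult_right_mono) auto
        also have "\<dots> = (288 * A) powr p" using A(1) by (simp add: powr_mult[symmetric])
        finally show "72 * (4 powr p * A powr p) \<le> (288 * A) powr p" .
      qed
      finally show "(\<integral>\<^sup>+\<tau>. ennreal (u \<tau> powr p) \<partial>lborel) \<le> ennreal ((288 * A) powr p)" .
      show "(\<integral>\<^sup>+\<tau>. ennreal (tail_weight g \<tau> powr q) \<partial>lborel) \<le> ennreal ((2 * exp 1 * B) powr q)"
        using q B by (intro nn_integral_tail_weight_le) auto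
    qed (use A B v tail_weight_nonneg in \<open>auto simp: u_def indicator_def\<close>)
    finally show "(\<integral>\<^sup>+t. \<integral>\<^sup>+\<tau>. ennreal (v \<tau>) * (dmajorant g t * N t \<tau>) \<partial>lborel \<partial>lborel)
      \<le> ennreal (288 * A * (2 * exp 1 * B))" .
  qed (use f0 A in \<open>auto intro!: ennreal_leI\<close>)
  also have "\<dots> = ennreal ((1 + 576 * exp 1) * A * B)"
    using A(1) B(1) by (simp add: ennreal_mult[symmetric] ennreal_plus[symmetric] algebra_simps del: ennreal_plus)
  finally show ?thesis .
qed

section \<open>Boundedness of the operator\<close>

lemma hardy_norm_inf_le:
  assumes "\<And>z. cmod z < 1 \<Longrightarrow> ennreal (cmod (h z)) \<le> M"
  shows "hardy_norm_inf h \<le> M"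
  unfolding hardy_norm_inf_def hardy_mean_inf_def
  by (intro SUP_least assms) (auto simp: norm_mult)

text \<open>One form for the three spaces, with a constant chosen before \<open>f\<close> and
  \<open>g\<close>, so that the final argument can treat \<open>X\<close> abstractly.\<close>

lemma T_op_bound_uniform:
  assumes "1 < p" "1 / p + 1 / q = 1" and X: "X \<in> {hardy_norm p, dirichlet_norm p, HL_norm p}"
  shows "\<exists>C>0. \<forall>f g A B z. f holomorphic_on ball 0 1 \<longrightarrow> g holomorphic_on ball 0 1 \<longrightarrow>
    0 < A \<longrightarrow> X f \<le> ennreal A \<longrightarrow> 0 < B \<longrightarrow> coeff_sum q g \<le> ennreal (B powr q) \<longrightarrow> cmod z < 1 \<longrightarrow>
    ennreal (cmod (T_op g f z)) \<le> ennreal (C * A * B)"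
proof -
  have q: "1 < q" using assms(1,2) by (rule conjugate_exponent_gt_1)
  consider "X = hardy_norm p" | "X = dirichlet_norm p" | "X = HL_norm p" using X by auto
  then show ?thesis
  proof cases
    case 1
    show ?thesis unfolding 1
      by (rule exI[of _ "24 * exp 1 * (p + q)"])
         (use assms(1) q T_op_bound_hardy[OF assms(1,2)] in \<open>auto intro: mult_pos_pos\<close>)
  next
    case 2
    show ?thesis unfolding 2
      by (rule exI[of _ "1 + 576 * exp 1"])
         (use T_op_bound_dirichlet[OF assms(1,2)] in \<open>auto intro: add_pos_pos\<close>)
  next
    case 3
    show ?thesis unfolding 3
      by (rule exI[of _ 1]) (use T_op_bound_HL[OF assms(1,2)] in auto)
  qed
qed

text \<open>The bounds above ask for strictly positive \<open>A\<close> and \<open>B\<close>;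
  letting \<open>e\<close> tend to 0 also covers a vanishing norm or coefficient sum.\<close>

lemma ennreal_le_mult_epsilon:
  fixes x :: ennreal
  assumes "0 \<le> c" "0 \<le> a" "0 \<le> b" and le: "\<And>e. 0 < e \<Longrightarrow> x \<le> ennreal (c * (a + e) * (b + e))"
  shows "x \<le> ennreal (c * a * b)"
proof (rule tendsto_lowerbound)
  have "((\<lambda>e. c * (a + e) * (b + e)) \<longlongrightarrow> c * (a + 0) * (b + 0)) (at_right 0)"
    by (intro tendsto_intros)
  then show "((\<lambda>e. ennreal (c * (a + e) * (b + e))) \<longlongrightarrow> ennreal (c * a * b)) (at_right 0)"
    by (intro tendsto_ennrealI) simp
  show "\<forall>\<^sub>F e in at_right 0. x \<le> ennreal (c * (a + e) * (b + e))"
    using le by (auto simp: eventually_at_right_less intro: eventually_mono[OF eventually_at_right_less])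
qed simp

theorem theorem10:
  fixes p p' :: real and X :: "(complex \<Rightarrow> complex) \<Rightarrow> ennreal"
  assumes "1 < p" and "1 / p + 1 / p' = 1"
    and "X \<in> {hardy_norm p, dirichlet_norm p, HL_norm p}"
  shows "\<exists>C::real. C > 0 \<and>
    (\<forall>g. g holomorphic_on ball 0 1 \<longrightarrow> coeff_sum p' g < \<infinity> \<longrightarrow>
       bounded_op (T_op g) X hardy_norm_inf \<and>
       epowr (op_norm (T_op g) X hardy_norm_inf) p' \<le> ennreal C * coeff_sum p' g)"
proof -
  have p': "1 < p'" using assms(1,2) by (rule conjugate_exponent_gt_1)
  obtain C where C: "0 < C" and bound: "\<And>f g A B z. f holomorphic_on ball 0 1 \<Longrightarrow> g holomorphic_on ball 0 1 \<Longrightarrow>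
    0 < A \<Longrightarrow> X f \<le> ennreal A \<Longrightarrow> 0 < B \<Longrightarrow> coeff_sum p' g \<le> ennreal (B powr p') \<Longrightarrow> cmod z < 1 \<Longrightarrow>
    ennreal (cmod (T_op g f z)) \<le> ennreal (C * A * B)"
    using T_op_bound_uniform[OF assms] by blast
  show ?thesis
  \<comment> \<open>The operator norm will be at most \<open>C * B\<close> with
    \<open>B powr p'\<close> equal to the coefficient sum; raising this to the power
    \<open>p'\<close> gives the witness.\<close>
  proof (intro exI[of _ "C powr p'"] conjI allI impI)
    show "0 < C powr p'" using C by simp
    fix g assume g: "g holomorphic_on ball 0 1" and fin: "coeff_sum p' g < \<infinity>"
    define s where "s = enn2real (coeff_sum p' g)"
    have s: "coeff_sum p' g = ennreal s" "0 \<le> s" using fin by (auto simp: s_def)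
    define B where "B = s powr (1 / p')"
    have B: "0 \<le> B" "B powr p' = s" using s p' by (auto simp: B_def powr_powr)
    \<comment> \<open>Stated for any real upper bound \<open>a\<close> of the norm: the norm itself
      gives boundedness, and \<open>a = 1\<close> gives the operator norm.\<close>
    have le: "hardy_norm_inf (T_op g f) \<le> ennreal (C * a * B)"
      if f: "f holomorphic_on ball 0 1" and a: "X f \<le> ennreal a" "0 \<le> a" for f a
    proof (rule hardy_norm_inf_le, rule ennreal_le_mult_epsilon)
      fix z :: complex and e :: real assume z: "cmod z < 1" and e: "0 < e"
      have "B powr p' \<le> (B + e) powr p'" using B e p' by (intro powr_mono2) auto
      then have "coeff_sum p' g \<le> ennreal ((B + e) powr p')" using s B by (simp add: ennreal_leI)
      moreover have "X f \<le> ennreal (a + e)" using a e by (meson ennreal_leI less_imp_le le_add_same_cancel1 order_trans)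
      ultimately show "ennreal (cmod (T_op g f z)) \<le> ennreal (C * (a + e) * (B + e))"
        using a B e z by (intro bound f g) auto
    qed (use C a B in auto)
    show "bounded_op (T_op g) X hardy_norm_inf"
      unfolding bounded_op_def
    proof (intro conjI ballI exI[of _ "C * B"])
      fix f assume "f \<in> hol_space X"
      then have f: "f holomorphic_on ball 0 1" "X f < \<infinity>" by (auto simp: hol_space_def)
      then have Xf: "X f = ennreal (enn2real (X f))" by simp
      have le': "hardy_norm_inf (T_op g f) \<le> ennreal (C * enn2real (X f) * B)"
        using f(1) Xf by (intro le) auto
      then have "hardy_norm_inf (T_op g f) < \<infinity>" by (rule le_less_trans) simp
      then show "T_op g f \<in> hol_space hardy_norm_inf"
        using T_op_holomorphic[OF f(1) g] by (simp add: hol_space_def)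
      have "ennreal (C * enn2real (X f) * B) = ennreal (C * B) * X f"
        using C B by (subst (2) Xf) (simp add: ennreal_mult[symmetric] mult_ac)
      with le' show "hardy_norm_inf (T_op g f) \<le> ennreal (C * B) * X f" by simp
    qed
    have "op_norm (T_op g) X hardy_norm_inf \<le> ennreal (C * B)"
      unfolding op_norm_def
    proof (rule SUP_least)
      fix f assume "f \<in> {f \<in> hol_space X. X f \<le> 1}"
      then show "hardy_norm_inf (T_op g f) \<le> ennreal (C * B)"
        using le[of f 1] by (auto simp: hol_space_def)
    qed
    then have "epowr (op_norm (T_op g) X hardy_norm_inf) p' \<le> epowr (ennreal (C * B)) p'"
      using p' by (intro epowr_mono) auto
    also have "\<dots> = ennreal (C powr p') * coeff_sum p' g"
      using C B s by (subst epowr_ennreal) (auto simp: powr_mult ennreal_mult)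
    finally show "epowr (op_norm (T_op g) X hardy_norm_inf) p' \<le> ennreal (C powr p') * coeff_sum p' g" .
  qed
qed

end
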